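(* Let $(P_1,\dots,P_d)\sim \text{Vec-NIFPP}(q_M,H,P_0)$ and let $\boldsymbol\theta=(\boldsymbol\theta_1,\dots,\boldsymbol\theta_d)$, $\boldsymbol\theta_j=(\theta_{j,1},\dots,\theta_{j,n_j})$ with $n_j\ge 1$, be a sample such that, conditionally on $(P_1,\dots,P_d)$, the $\theta_{j,i}$ are independent with $\theta_{j,i}\sim P_j$. Put $n=n_1+\dots+n_d$. Let $K\geq 1$ and let $\boldsymbol n_j=(n_{j,1},\dots,n_{j,K})$, $j=1,\dots,d$, be vectors of non-negative integers with $\sum_{k=1}^K n_{j,k}=n_j$ for every $j$ and $\sum_{j=1}^d n_{j,k}>0$ for every $k$. Then the probability of observing a sample exhibiting $K$ distinct values with respective counts $\boldsymbol n_1,\dots,\boldsymbol n_d$ (i.e. the pEPPF $\Pi^{(n)}_K(\boldsymbol n_1,\dots,\boldsymbol n_d)$ defined in the context) is $$\Pi_K^{(n)}(\boldsymbol n_1,\dots,\boldsymbol n_d)=\int_{(0,\infty)^d}\prod_{j=1}^d\left\{\frac{u_j^{n_j-1}}{\Gamma(n_j)}\prod_{k=1}^K\kappa_j(u_j,n_{j,k})\right\}\Psi(K,\boldsymbol u)\,\mathrm du_1\cdots \mathrm du_d,$$ where, with $\boldsymbol u=(u_1,\dots,u_d)$, $$\Psi(K,\boldsymbol u)=\sum_{m=0}^\infty q_M(m+K)\frac{(m+K)!}{m!}\prod_{j=1}^d(\psi_j(u_j))^m,$$ $$\psi_j(u_j)=\int_0^\infty e^{-u_js}H_j(\mathrm ds),\qquad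 \kappa_j(u_j,n_{j,k})=\int_0^\infty e^{-u_js}s^{n_{j,k}}H_j(\mathrm ds).$$
   Context: Setting. $d\ge1$ is an integer, $\Theta\subset\mathbb R^s$ is a (Borel) parameter space, $P_0$ is a diffuse (non-atomic) probability measure on $\Theta$, $q_M$ is a probability mass function on $\{1,2,3,\dots\}$, and $H=H_1\times\dots\times H_d$, where $H_j(\mathrm ds)=h(s\mid\gamma_j)\,\mathrm ds$ are probability distributions on $(0,\infty)$ with densities from a common parametric family, with parameters $\gamma_j>0$. Let $M\sim q_M$; conditionally on $M$, let $S_{j,m}$ ($1\le j\le d$, $1\le m\le M$) be independent with $S_{j,m}\sim H_j$, and let $\tau_1,\dots,\tau_M$ be i.i.d. from $P_0$, independent of the $S_{j,m}$. Put $\mu_j=\sum_{m=1}^M S_{j,m}\delta_{\tau_m}$, $T_j=\mu_j(\Theta)$, $P_j=\mu_j/T_j$. The law of $(P_1,\dots,P_d)$ is denoted $\text{Vec-NIFPP}(q_M,H,P_0)$. Partially exchangeable partition probability function (pEPPF). Informally, $\Pi_K^{(n)}(\boldsymbol n_1,\dots,\boldsymbol n_d)=\mathbb E\left[\int_{\Theta^K}\prod_{j=1}^d\prod_{k=1}^K P_j^{n_{j,k}}(\mathrm d\theta^{**}_k)\right]$ with $\theta^{**}_1,\dots,\theta^{**}_K$ distinct. Precisely, it is the probability that the random partition of the index set $\{(j,i):1\le j\le d,\,1\le i\le n_j\}$ induced by the ties ($(j,i)$ and $(j',i')$ are in the same block iff $\theta_{j,i}=\theta_{j',i'}$) equals a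 given fixed partition into $K$ blocks $C_1,\dots,C_K$ in which block $C_k$ contains exactly $n_{j,k}$ indices of group $j$, for all $j,k$; this probability depends on the partition only through the counts. *)

theory Defs
  imports "HOL-Probability.Probability"
begin

text \<open>The discrete measure \<open>\<Sum>m=1..M. s m \<cdot> \<delta>\<^bsub>t m\<^esub>\<close> on the measurable space of \<open>B\<close>: the image under \<open>t\<close>
  of the measure on \<open>{1..M}\<close> with masses \<open>s\<close>; see \<open>emeasure_discrete_measure\<close> below.\<close>

definition discrete_measure ::
    "'a measure \<Rightarrow> nat \<Rightarrow> (nat \<Rightarrow> real) \<Rightarrow> (nat \<Rightarrow> 'a) \<Rightarrow> 'a measure" where
  "discrete_measure B M s t = distr (point_measure {1..M} (\<lambda>m. ennreal (s m))) B t"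

definition normalized :: "'a measure \<Rightarrow> 'a measure" where
  "normalized \<mu> = scale_measure (1 / emeasure \<mu> (space \<mu>)) \<mu>"

lemma emeasure_discrete_measure:
  assumes t: "\<And>m. m \<in> {1..M} \<Longrightarrow> t m \<in> space B" and A: "A \<in> sets B"
  shows "emeasure (discrete_measure B M s t) A = (\<Sum>m\<in>{1..M}. ennreal (s m) * emeasure (return B (t m)) A)"
proof -
  have "emeasure (discrete_measure B M s t) A
      = emeasure (point_measure {1..M} (\<lambda>m. ennreal (s m))) (t -` A \<inter> {1..M})"
    using t A by (simp add: discrete_measure_def emeasure_distr space_point_measure)
  also have "\<dots> = (\<Sum>m\<in>t -` A \<inter> {1..M}. ennreal (s m))"
    by (rule emeasure_point_measure_finite) auto
  also have "\<dots> = (\<Sum>m\<in>{1..M}. if t m \<in> A then ennreal (s m) else 0)"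
    by (subst sum.inter_filter[symmetric]) (auto intro: sum.cong)
  also have "\<dots> = (\<Sum>m\<in>{1..M}. ennreal (s m) * emeasure (return B (t m)) A)"
    using A by (intro sum.cong) (auto simp: indicator_def)
  finally show ?thesis .
qed

text \<open>Law of the vector \<open>(P\<^sub>1,\<dots>,P\<^sub>d)\<close> of normalized independent finite point processes, a probability
  measure on the \<open>d\<close>-fold product of the space of probability measures on \<open>\<Theta> = space P0\<close>.
  The jumps are \<open>S (j, m)\<close>; the atoms \<open>t m\<close> are shared by all groups.\<close>

definition vec_nifpp ::
    "nat \<Rightarrow> nat pmf \<Rightarrow> (nat \<Rightarrow> real measure) \<Rightarrow> 'a measure \<Rightarrow> (nat \<Rightarrow> 'a measure) measure" where
  "vec_nifpp d q H P0 =
     measure_pmf q \<bind> (\<lambda>M.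
       distr ((\<Pi>\<^sub>M (j, m)\<in>{1..d} \<times> {1..M}. H j) \<Otimes>\<^sub>M (\<Pi>\<^sub>M m\<in>{1..M}. P0))
             (\<Pi>\<^sub>M j\<in>{1..d}. prob_algebra P0)
             (\<lambda>(S, t). \<lambda>j\<in>{1..d}. normalized (discrete_measure P0 M (\<lambda>m. S (j, m)) t)))"

text \<open>The map whose image law defines \<open>vec_nifpp\<close> is measurable, so the \<open>distr\<close> there is a genuine push-forward.\<close>

lemma measurable_normalized_discrete:
  assumes H: "\<And>j. j \<in> {1..d} \<Longrightarrow> sets (H j) = sets (restrict_space borel {0<..})"
    and M: "M \<ge> 1"
  shows "(\<lambda>(S, t). \<lambda>j\<in>{1..d}. normalized (discrete_measure P0 M (\<lambda>m. S (j, m)) t))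
    \<in> (\<Pi>\<^sub>M (j, m)\<in>{1..d} \<times> {1..M}. H j) \<Otimes>\<^sub>M (\<Pi>\<^sub>M m\<in>{1..M}. P0) \<rightarrow>\<^sub>M (\<Pi>\<^sub>M j\<in>{1..d}. prob_algebra P0)"
    (is "?f \<in> ?D \<rightarrow>\<^sub>M _")
proof -
  let ?N = "\<lambda>j (S, t). normalized (discrete_measure P0 M (\<lambda>m. S (j, m)) t)"
  have N: "?N j \<in> ?D \<rightarrow>\<^sub>M prob_algebra P0" if j: "j \<in> {1..d}" for j
  proof -
    have posS: "x (j, m) > 0" if "x \<in> space (\<Pi>\<^sub>M (j, m)\<in>{1..d} \<times> {1..M}. H j)" "m \<in> {1..M}" for x m
    proof -
      have "x (j, m) \<in> space (H j)" using that j by (auto simp: space_PiM PiE_iff)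
      also have "space (H j) = {0<..}" using sets_eq_imp_space_eq[OF H[OF j]] by (simp add: space_restrict_space)
      finally show ?thesis by simp
    qed
    have mS: "(\<lambda>x. fst x (j, m)) \<in> borel_measurable ?D" if m: "m \<in> {1..M}" for m
    proof -
      have "(\<lambda>S. S (j, m)) \<in> (\<Pi>\<^sub>M (j, m)\<in>{1..d} \<times> {1..M}. H j) \<rightarrow>\<^sub>M H j"
        using measurable_component_singleton[of "(j,m)" "{1..d} \<times> {1..M}" "\<lambda>(j,m). H j"] j m by simp
      then have "(\<lambda>S. S (j, m)) \<in> (\<Pi>\<^sub>M (j, m)\<in>{1..d} \<times> {1..M}. H j) \<rightarrow>\<^sub>M restrict_space borel {0<..}"
        using measurable_cong_sets[OF refl H[OF j]] by blast
      then have "(\<lambda>S. S (j, m)) \<in> borel_measurable (\<Pi>\<^sub>M (j, m)\<in>{1..d} \<times> {1..M}. H j)"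
        by (auto simp: measurable_restrict_space2_iff)
      then show ?thesis by (rule measurable_compose[OF measurable_fst])
    qed
    have mt: "(\<lambda>x. snd x m) \<in> ?D \<rightarrow>\<^sub>M P0" if "m \<in> {1..M}" for m
      using measurable_compose[OF measurable_snd measurable_component_singleton[OF that, of "\<lambda>_. P0"]] .
    have em: "emeasure (discrete_measure P0 M (\<lambda>m. fst x (j, m)) (snd x)) A =
      (\<Sum>m\<in>{1..M}. ennreal (fst x (j, m)) * indicator A (snd x m))"
      if x: "x \<in> space ?D" and A: "A \<in> sets P0" for x A
      using x A by (subst emeasure_discrete_measure) (auto simp: space_pair_measure space_PiM PiE_iff)
    have sp: "emeasure (discrete_measure P0 M (\<lambda>m. fst x (j, m)) (snd x)) (space P0) =
       ennreal (\<Sum>m\<in>{1..M}. fst x (j, m))" if x: "x \<in> space ?D" for x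
      using x posS[of "fst x"] em[OF x sets.top]
      by (auto simp: space_pair_measure space_PiM PiE_iff indicator_def less_imp_le intro!: sum.cong trans[OF _ sum_ennreal])
    have sppos: "(\<Sum>m\<in>{1..M}. fst x (j, m)) > 0" if x: "x \<in> space ?D" for x
      using x posS[of "fst x"] M by (intro sum_pos) (auto simp: space_pair_measure)
    have ss: "space (discrete_measure P0 M a b) = space P0" "sets (discrete_measure P0 M a b) = sets P0" for a b
      by (auto simp: discrete_measure_def)
    have pr: "prob_space (?N j x)" if x: "x \<in> space ?D" for x
      using sp[OF x] sppos[OF x]
      by (intro prob_spaceI) (auto simp: split_beta normalized_def ss space_scale_measure divide_ennreal
         ennreal_1[symmetric] ennreal_mult[symmetric] simp del: ennreal_1)
    have "?N j \<in> ?D \<rightarrow>\<^sub>M subprob_algebra P0"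
    proof (rule measurable_subprob_algebra)
      fix x assume x: "x \<in> space ?D"
      show "subprob_space (?N j x)" using pr[OF x] by (rule prob_space_imp_subprob_space)
      show "sets (?N j x) = sets P0" by (auto simp: split_beta normalized_def ss)
    next
      fix A assume A: "A \<in> sets P0"
      have "(\<lambda>x. 1 / ennreal (\<Sum>m\<in>{1..M}. fst x (j, m)) * 
         (\<Sum>m\<in>{1..M}. ennreal (fst x (j, m)) * indicator A (snd x m))) \<in> borel_measurable ?D"
      proof (intro borel_measurable_times_ennreal borel_measurable_divide_ennreal borel_measurable_sum borel_measurable_const)
        show "(\<lambda>x. ennreal (\<Sum>m\<in>{1..M}. fst x (j, m))) \<in> borel_measurable ?D"
          using mS by (intro measurable_compose[OF _ measurable_ennreal] borel_measurable_sum)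
        show "(\<lambda>x. ennreal (fst x (j, m))) \<in> borel_measurable ?D" if "m \<in> {1..M}" for m
          using mS[OF that] by (rule measurable_compose[OF _ measurable_ennreal])
        show "(\<lambda>x. indicator A (snd x m) :: ennreal) \<in> borel_measurable ?D" if "m \<in> {1..M}" for m
          using measurable_compose[OF mt[OF that] borel_measurable_indicator[OF A]] .
      qed
      then show "(\<lambda>x. emeasure (?N j x) A) \<in> borel_measurable ?D"
        by (rule measurable_cong[THEN iffD1, rotated])
           (simp add: split_beta normalized_def ss em[OF _ A] sp)
    qed
    with pr show ?thesis by (intro measurable_prob_algebraI) auto
  qed
  have "?f = (\<lambda>x. \<lambda>j\<in>{1..d}. ?N j x)" by auto
  with N show ?thesis by (auto intro!: measurable_restrict)
qed

definition sample_index :: "nat \<Rightarrow> (nat \<Rightarrow> nat) \<Rightarrow> (nat \<times> nat) set" where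
  "sample_index d n = (SIGMA j:{1..d}. {1..n j})"

text \<open>Conditionally on the \<open>\<sigma>\<close>-algebra generated by the random vector \<open>P\<close> of probability measures on
  the measurable space of \<open>B\<close>, the \<open>\<theta> (j, i)\<close> are independent with law \<open>P j\<close>.\<close>

definition conditional_sample ::
    "'w measure \<Rightarrow> 'a measure \<Rightarrow> nat \<Rightarrow> (nat \<Rightarrow> nat) \<Rightarrow> ('w \<Rightarrow> nat \<Rightarrow> 'a measure)
      \<Rightarrow> (nat \<times> nat \<Rightarrow> 'w \<Rightarrow> 'a) \<Rightarrow> bool" where
  "conditional_sample W B d n P \<theta> \<longleftrightarrow>
     P \<in> W \<rightarrow>\<^sub>M (\<Pi>\<^sub>M j\<in>{1..d}. prob_algebra B) \<and>
     (\<forall>x\<in>sample_index d n. \<theta> x \<in> W \<rightarrow>\<^sub>M B) \<and>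
     (\<forall>A. (\<forall>x\<in>sample_index d n. A x \<in> sets B) \<longrightarrow>
        (AE w in W.
           real_cond_exp W (vimage_algebra (space W) P (\<Pi>\<^sub>M j\<in>{1..d}. prob_algebra B))
             (indicator {w \<in> space W. \<forall>x\<in>sample_index d n. \<theta> x w \<in> A x}) w
           = (\<Prod>(j, i)\<in>sample_index d n. measure (P w j) (A (j, i)))))"

definition tie_partition :: "'i set \<Rightarrow> ('i \<Rightarrow> 'a) \<Rightarrow> 'i set set" where
  "tie_partition I x = I // {(a, b) \<in> I \<times> I. x a = x b}"

text \<open>\<open>C 1, \<dots>, C K\<close> are the blocks of a partition, and \<open>C k\<close> has \<open>c j k\<close> indices of group \<open>j\<close>.\<close>

definition blocks_with_counts ::
    "nat \<Rightarrow> (nat \<Rightarrow> nat) \<Rightarrow> nat \<Rightarrow> (nat \<Rightarrow> nat \<Rightarrow> nat) \<Rightarrow> (nat \<Rightarrow> (nat \<times> nat) set) \<Rightarrow> bool" where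
  "blocks_with_counts d n K c C \<longleftrightarrow>
     inj_on C {1..K} \<and> partition_on (sample_index d n) (C ` {1..K}) \<and>
     (\<forall>j\<in>{1..d}. \<forall>k\<in>{1..K}. card {i. (j, i) \<in> C k} = c j k)"

text \<open>Probability that the ties of the sample induce the partition into the blocks \<open>C 1, \<dots>, C K\<close>;
  this is the pEPPF evaluated at the counts of \<open>C\<close>.\<close>

definition partition_prob ::
    "'w measure \<Rightarrow> nat \<Rightarrow> (nat \<Rightarrow> nat) \<Rightarrow> (nat \<times> nat \<Rightarrow> 'w \<Rightarrow> 'a) \<Rightarrow> nat
      \<Rightarrow> (nat \<Rightarrow> (nat \<times> nat) set) \<Rightarrow> real" where
  "partition_prob W d n \<theta> K C =
     measure W {w \<in> space W. tie_partition (sample_index d n) (\<lambda>x. \<theta> x w) = C ` {1..K}}"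

definition laplace :: "real measure \<Rightarrow> real \<Rightarrow> real" where
  "laplace H u = (\<integral>s. exp (- u * s) \<partial>H)"

definition kappa :: "real measure \<Rightarrow> real \<Rightarrow> nat \<Rightarrow> real" where
  "kappa H u r = (\<integral>s. exp (- u * s) * s ^ r \<partial>H)"

definition Psi :: "nat \<Rightarrow> nat pmf \<Rightarrow> (nat \<Rightarrow> real measure) \<Rightarrow> nat \<Rightarrow> (nat \<Rightarrow> real) \<Rightarrow> real" where
  "Psi d q H K u =
     (\<Sum>m. pmf q (m + K) * (fact (m + K) / fact m) * (\<Prod>j\<in>{1..d}. laplace (H j) (u j) ^ m))"

definition peppf_integrand ::
    "nat \<Rightarrow> nat pmf \<Rightarrow> (nat \<Rightarrow> real measure) \<Rightarrow> (nat \<Rightarrow> nat) \<Rightarrow> nat \<Rightarrow> (nat \<Rightarrow> nat \<Rightarrow> nat)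
      \<Rightarrow> (nat \<Rightarrow> real) \<Rightarrow> real" where
  "peppf_integrand d q H n K c u =
     (\<Prod>j\<in>{1..d}. u j ^ (n j - 1) / Gamma (real (n j)) * (\<Prod>k\<in>{1..K}. kappa (H j) (u j) (c j k)))
       * Psi d q H K u"

end

theory Submission
  imports Defs
begin

text \<open>
  Given \<open>M\<close> atoms with jumps \<open>S\<^bsub>j,m\<^esub>\<close>, expanding the product of the discrete measures \<open>P\<^sub>j\<close> shows that the
  sample is distributed as \<open>\<tau> \<circ> f\<close>, where the random labeling \<open>f\<close> of the indices by atoms has probability
  \<open>E (\<Prod>\<^bsub>j,i\<^esub> S\<^bsub>j,f(j,i)\<^esub> / T\<^sub>j)\<close>. As \<open>P0\<close> is diffuse, the ties of the sample are almost surely those of \<open>f\<close>.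
  The identity \<open>T\<^bsup>-n\<^esup> = 1/\<Gamma>(n) \<integral> u\<^bsup>n-1\<^esup> exp (-u T) du\<close> decouples the jumps, so that a labeling
  with block counts \<open>c\<close> has probability
  \<open>\<integral> \<Prod>\<^sub>j u\<^sub>j\<^bsup>n\<^sub>j-1\<^esup> / \<Gamma>(n\<^sub>j) (\<Prod>\<^sub>k \<kappa>\<^sub>j(u\<^sub>j, c\<^bsub>j,k\<^esub>)) \<psi>\<^sub>j(u\<^sub>j)\<^bsup>M-K\<^esup> du\<close>; there are
  \<open>M!/(M-K)!\<close> labelings with the prescribed ties, and summing over \<open>M = m + K\<close> produces \<open>\<Psi>\<close>.
\<close>

subsection \<open>Ties and labelings\<close>

text \<open>The relation is recovered from its partition: two indices are tied iff some block
  contains both. Events about partitions thereby become finitely many conditions on pairs of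
  indices.\<close>

lemma tie_partition_eq_iff:
  "tie_partition I x = tie_partition I y \<longleftrightarrow> (\<forall>a\<in>I. \<forall>b\<in>I. x a = x b \<longleftrightarrow> y a = y b)"
proof
  have x: "x a = x b \<longleftrightarrow> (\<exists>X\<in>tie_partition I x. a \<in> X \<and> b \<in> X)" if "a \<in> I" "b \<in> I" for a b
    using that by (auto simp: tie_partition_def quotient_def)
  have y: "y a = y b \<longleftrightarrow> (\<exists>X\<in>tie_partition I y. a \<in> X \<and> b \<in> X)" if "a \<in> I" "b \<in> I" for a b
    using that by (auto simp: tie_partition_def quotient_def)
  show "\<forall>a\<in>I. \<forall>b\<in>I. x a = x b \<longleftrightarrow> y a = y b" if "tie_partition I x = tie_partition I y"
  proof (intro ballI)
    fix a b assume ab: "a \<in> I" "b \<in> I"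
    show "x a = x b \<longleftrightarrow> y a = y b"
      unfolding x[OF ab] y[OF ab] that ..
  qed
next
  assume "\<forall>a\<in>I. \<forall>b\<in>I. x a = x b \<longleftrightarrow> y a = y b"
  then have "{(a, b) \<in> I \<times> I. x a = x b} = {(a, b) \<in> I \<times> I. y a = y b}" by auto
  then show "tie_partition I x = tie_partition I y" by (simp add: tie_partition_def)
qed

text \<open>Injectivity of \<open>C\<close> and disjointness of the blocks give each index a unique
  block number. The resulting \<open>b\<close> is a reference labeling with exactly the prescribed
  ties, and it replaces \<open>C\<close> in everything that follows.\<close>

lemma partition_block_index:
  assumes inj: "inj_on C J" and part: "partition_on I (C ` J)"
  shows "\<exists>b. b ` I = J \<and> tie_partition I b = C ` J \<and> (\<forall>k\<in>J. C k = {x \<in> I. b x = k})"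
proof (intro exI conjI ballI)
  define b where "b x = (THE k. k \<in> J \<and> x \<in> C k)" for x
  have disj: "k = l" if "k \<in> J" "l \<in> J" "x \<in> C k" "x \<in> C l" for k l x
  proof -
    have "disjoint (C ` J)" using part by (simp add: partition_on_def)
    from disjointD[OF this, of "C k" "C l"] have "C k = C l" using that by auto
    then show ?thesis using that inj by (auto dest: inj_onD)
  qed
  have ex: "\<exists>k. k \<in> J \<and> x \<in> C k" if "x \<in> I" for x
    using that part by (auto simp: partition_on_def)
  have b: "b x \<in> J \<and> x \<in> C (b x)" if "x \<in> I" for x
    unfolding b_def by (rule theI') (use ex[OF that] disj in blast)
  have sub: "C k \<subseteq> I" "C k \<noteq> {}" if "k \<in> J" for k
    using that part by (auto simp: partition_on_def)
  show Ck: "C k = {x \<in> I. b x = k}" if "k \<in> J" for k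
    using b sub(1)[OF that] disj[OF that] that by (auto; metis)
  show surj: "b ` I = J"
  proof
    show "b ` I \<subseteq> J" using b by auto
    show "J \<subseteq> b ` I"
    proof
      fix k assume "k \<in> J"
      then obtain x where "x \<in> C k" using sub(2) by auto
      then show "k \<in> b ` I" using Ck[OF \<open>k \<in> J\<close>] by auto
    qed
  qed
  show "tie_partition I b = C ` J"
  proof -
    have "tie_partition I b = (\<lambda>a. {x \<in> I. b a = b x}) ` I"
      by (auto simp: tie_partition_def quotient_def)
    also have "\<dots> = (\<lambda>k. {x \<in> I. k = b x}) ` (b ` I)" by (simp add: image_image)
    also have "\<dots> = C ` J" unfolding surj using Ck by (intro image_cong) auto
    finally show ?thesis .
  qed
qed

text \<open>A map with the same ties as \<open>b\<close> factors uniquely through \<open>b\<close>,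
  and the factor is injective. In the application it assigns to each block its own atom.\<close>

lemma bij_betw_labelings:
  assumes b: "b ` I = J"
  shows "bij_betw (\<lambda>g. \<lambda>x\<in>I. g (b x)) {g \<in> J \<rightarrow>\<^sub>E B. inj_on g J}
    {f \<in> I \<rightarrow>\<^sub>E B. \<forall>x\<in>I. \<forall>y\<in>I. f x = f y \<longleftrightarrow> b x = b y}"
proof (rule bij_betw_imageI)
  let ?F = "\<lambda>g. \<lambda>x\<in>I. g (b x)"
  show "inj_on ?F {g \<in> J \<rightarrow>\<^sub>E B. inj_on g J}"
  proof (rule inj_onI)
    fix g h assume gh: "g \<in> {g \<in> J \<rightarrow>\<^sub>E B. inj_on g J}" "h \<in> {g \<in> J \<rightarrow>\<^sub>E B. inj_on g J}" and eq: "?F g = ?F h"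
    show "g = h"
    proof (rule PiE_ext[of g J "\<lambda>_. B" h])
      fix k assume "k \<in> J"
      then obtain x where x: "x \<in> I" "k = b x" using b by auto
      show "g k = h k" using fun_cong[OF eq, of x] x by simp
    qed (use gh in auto)
  qed
  show "?F ` {g \<in> J \<rightarrow>\<^sub>E B. inj_on g J} = {f \<in> I \<rightarrow>\<^sub>E B. \<forall>x\<in>I. \<forall>y\<in>I. f x = f y \<longleftrightarrow> b x = b y}" (is "?L = ?R")
  proof
    show "?L \<subseteq> ?R" using b by (auto simp: inj_on_def)
    show "?R \<subseteq> ?L"
    proof
      fix f assume f: "f \<in> ?R"
      \<comment> \<open>\<open>f\<close> is constant on the fibres of \<open>b\<close>, so any
        representative of block \<open>k\<close> gives the same value; a fibre over \<open>J\<close>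
        is nonempty because \<open>b\<close> is onto.\<close>
      define g where "g = (\<lambda>k\<in>J. f (SOME x. x \<in> I \<and> b x = k))"
      have s: "(SOME x. x \<in> I \<and> b x = k) \<in> I \<and> b (SOME x. x \<in> I \<and> b x = k) = k" if "k \<in> J" for k
        using that b by (intro someI_ex[of "\<lambda>x. x \<in> I \<and> b x = k"]) auto
      have gb: "g (b x) = f x" if "x \<in> I" for x
        using s[of "b x"] that b f by (auto simp: g_def)
      have "g \<in> {g \<in> J \<rightarrow>\<^sub>E B. inj_on g J}"
        using s f by (auto simp: g_def inj_on_def PiE_iff)
      moreover have "f = ?F g" using gb f by (intro ext) (auto simp: PiE_iff extensional_def)
      ultimately show "f \<in> ?L" by blast
    qed
  qed
qed

text \<open>Counting injections of blocks into labels gives a falling factorial. With truncated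
  subtraction it contains the factor 0 when there are fewer labels than blocks, which is the right
  count.\<close>

lemma card_labelings:
  assumes b: "b ` I = J" and J: "finite J" and B: "finite B"
  shows "card {f \<in> I \<rightarrow>\<^sub>E B. \<forall>x\<in>I. \<forall>y\<in>I. f x = f y \<longleftrightarrow> b x = b y} = (\<Prod>i<card J. card B - i)"
  using bij_betw_same_card[OF bij_betw_labelings[OF b, of B]] card_inj_on_subset_funcset[OF J B subset_refl]
  by (simp add: lessThan_atLeast0)

lemma prod_diff_eq_fact_div: "(\<Prod>i<k. (m + k) - i) = fact (m + k) div (fact m :: nat)"
proof -
  have "(\<Prod>i<k. (m + k) - i) * fact m = (fact (m + k) :: nat)" for m
  proof (induction k arbitrary: m)
    case (Suc k)
    \<comment> \<open>The last factor, \<open>i = k\<close>, equals \<open>Suc m\<close>. It is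
      absorbed into \<open>fact (Suc m)\<close>, so the induction hypothesis is used at
      \<open>Suc m\<close> instead of \<open>m\<close>.\<close>
    have "(\<Prod>i<Suc k. (m + Suc k) - i) = (\<Prod>i<k. (Suc m + k) - i) * Suc m" by simp
    then have "(\<Prod>i<Suc k. (m + Suc k) - i) * fact m = (\<Prod>i<k. (Suc m + k) - i) * fact (Suc m)"
      by (simp only: fact_Suc of_nat_id mult.assoc)
    also have "\<dots> = fact (Suc m + k)" by (rule Suc)
    finally show ?case by (simp only: add_Suc_right add_Suc)
  qed simp
  then show ?thesis by (metis fact_nonzero nonzero_mult_div_cancel_right)
qed

lemma prod_diff_eq_0: "(\<Prod>i<k. m - i) = 0" if "m < k" for m :: nat
  using that by (auto intro!: bexI[of _ m])

subsection \<open>Laplace-type integrals of the jump distributions\<close>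

text \<open>The Erlang density with shape \<open>n\<close> and rate \<open>T\<close> has total mass
  1; its normalizing constant contains \<open>T ^ n\<close>. The library's parameter is the shape
  minus one.\<close>

lemma nn_integral_gamma_kernel:
  assumes n: "n \<ge> 1" and T: "T > 0"
  shows "(\<integral>\<^sup>+u. indicator {0<..} u * ennreal (u ^ (n - 1) / Gamma (real n) * exp (- u * T)) \<partial>lborel)
    = ennreal (1 / T ^ n)"
proof -
  interpret prob_space "density lborel (erlang_density (n - 1) T)"
    using T by (rule prob_space_erlang_density)
  have "1 = (\<integral>\<^sup>+u. ennreal (erlang_density (n - 1) T u) \<partial>lborel)"
    using emeasure_space_1 by (simp add: emeasure_density)
  also have "\<dots> = (\<integral>\<^sup>+u. ennreal (T ^ n) * (indicator {0<..} u * ennreal (u ^ (n - 1) / Gamma (real n) * exp (- u * T))) \<partial>lborel)"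
  proof (rule nn_integral_cong_AE)
    have G: "Gamma (real n) = fact (n - 1)"
      using n Gamma_fact[of "n - 1", where 'a = real] by simp
    \<comment> \<open>The Erlang density lives on the closed half line and the kernel on the open
      one; for \<open>n = 1\<close> they differ at 0.\<close>
    have "AE u in lborel. u \<noteq> (0::real)" by (rule AE_lborel_singleton)
    then show "AE u in lborel. ennreal (erlang_density (n - 1) T u) =
        ennreal (T ^ n) * (indicator {0<..} u * ennreal (u ^ (n - 1) / Gamma (real n) * exp (- u * T)))"
    proof eventually_elim
      case (elim u)
      then show ?case using n T G
        by (cases "u < 0") (auto simp: erlang_density_def ennreal_mult[symmetric] mult_ac)
    qed
  qed
  also have "\<dots> = ennreal (T ^ n) * (\<integral>\<^sup>+u. indicator {0<..} u * ennreal (u ^ (n - 1) / Gamma (real n) * exp (- u * T)) \<partial>lborel)"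
    by (intro nn_integral_cmult) measurable
  finally have eq: "ennreal (T ^ n) * (\<integral>\<^sup>+u. indicator {0<..} u * ennreal (u ^ (n - 1) / Gamma (real n) * exp (- u * T)) \<partial>lborel) = 1" (is "_ * ?I = 1")
    by simp
  have "ennreal (1 / T ^ n) = ennreal (1 / T ^ n) * (ennreal (T ^ n) * ?I)" by (simp only: eq mult_1_right)
  also have "\<dots> = ennreal (1 / T ^ n * T ^ n) * ?I" using T by (subst ennreal_mult) (simp_all only: mult.assoc, simp_all)
  finally show ?thesis using T by simp
qed

lemma power_le_fact_exp:
  fixes x :: real
  assumes "x \<ge> 0"
  shows "x ^ r \<le> fact r * exp x"
proof -
  have "x ^ r /\<^sub>R fact r \<le> (\<Sum>k<Suc r. x ^ k /\<^sub>R fact k)"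
    using assms by (intro member_le_sum) auto
  also have "\<dots> \<le> exp x"
    unfolding exp_def using assms by (intro sum_le_suminf summable_exp_generic) auto
  finally show ?thesis by (simp add: field_simps)
qed

text \<open>On the half line the integrand is bounded by \<open>fact r / u ^ r\<close>, since
  \<open>exp (u * s)\<close> dominates the single term \<open>(u * s) ^ r / fact r\<close> of its
  series. Hence the integral is finite for every jump law, even one whose moments are
  infinite.\<close>

lemma integrable_kappa:
  assumes H: "prob_space H" "sets H = sets (restrict_space borel {0<..})" and u: "u > 0"
  shows "integrable H (\<lambda>s::real. exp (- u * s) * s ^ r)"
proof -
  interpret prob_space H by fact
  have sp: "space H = {0<..}" using sets_eq_imp_space_eq[OF H(2)] by (simp add: space_restrict_space)
  have [measurable]: "(\<lambda>s. s) \<in> borel_measurable H"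
    by (subst measurable_cong_sets[OF H(2) refl]) (auto intro: measurable_restrict_space1)
  show ?thesis
  proof (rule integrable_const_bound[where B = "fact r / u ^ r"])
    show "AE s in H. norm (exp (- u * s) * s ^ r) \<le> fact r / u ^ r"
    proof (rule AE_I2)
      fix s assume "s \<in> space H"
      then have s: "s > 0" by (simp add: sp)
      have "(u * s) ^ r \<le> fact r * exp (u * s)" using s u by (intro power_le_fact_exp) auto
      then show "norm (exp (- u * s) * s ^ r) \<le> fact r / u ^ r"
        using s u by (simp add: field_simps power_mult_distrib exp_minus)
    qed
  qed measurable
qed

lemma nn_integral_kappa:
  assumes H: "prob_space H" "sets H = sets (restrict_space borel {0<..})" and u: "u > 0"
  shows "(\<integral>\<^sup>+s. ennreal (exp (- u * s) * s ^ r) \<partial>H) = ennreal (kappa H u r)"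
  unfolding kappa_def
proof (rule nn_integral_eq_integral[OF integrable_kappa[OF assms]])
  have sp: "space H = {0<..}" using sets_eq_imp_space_eq[OF H(2)] by (simp add: space_restrict_space)
  show "AE s in H. 0 \<le> exp (- u * s) * s ^ r" by (rule AE_I2) (auto simp: sp)
qed

text \<open>A strictly positive integrand has zero integral only if the whole space is null.
  Strictness is used at the end, where a positive weight is removed from a product to see that the
  series is finite.\<close>

lemma kappa_pos:
  assumes H: "prob_space H" "sets H = sets (restrict_space borel {0<..})" and u: "u > 0"
  shows "kappa H u r > 0"
proof -
  interpret prob_space H by fact
  have sp: "space H = {0<..}" using sets_eq_imp_space_eq[OF H(2)] by (simp add: space_restrict_space)
  have nn: "kappa H u r \<ge> 0" unfolding kappa_def by (rule integral_nonneg_AE) (auto simp: sp)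
  have "kappa H u r \<noteq> 0"
  proof
    assume "kappa H u r = 0"
    then have "(\<integral>\<^sup>+s. ennreal (exp (- u * s) * s ^ r) \<partial>H) = 0" using nn_integral_kappa[OF assms] by simp
    then have "AE s in H. ennreal (exp (- u * s) * s ^ r) = 0"
      using integrable_kappa[OF assms] by (subst (asm) nn_integral_0_iff_AE) auto
    then have "AE s in H. False"
      by (rule AE_mp) (auto intro!: AE_I2 simp: sp ennreal_eq_0_iff mult_le_0_iff not_le)
    then show False by simp
  qed
  with nn show ?thesis by simp
qed

text \<open>An atom without observations is treated as a block of size 0, so occupied and empty
  atoms can be handled by one formula.\<close>

lemma laplace_eq_kappa: "laplace H u = kappa H u 0"
  by (simp add: laplace_def kappa_def)

lemma borel_measurable_kappa:
  assumes H: "prob_space H" "sets H = sets (restrict_space borel {0<..})"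
  shows "(\<lambda>u. kappa H u r) \<in> borel_measurable borel"
proof -
  interpret prob_space H by fact
  have [measurable]: "(\<lambda>s. s) \<in> borel_measurable H"
    by (subst measurable_cong_sets[OF H(2) refl]) (auto intro: measurable_restrict_space1)
  show ?thesis unfolding kappa_def by measurable
qed

subsection \<open>Probability of a labeling\<close>

lemma finite_sample_index [simp]: "finite (sample_index d n)"
  by (simp add: sample_index_def)

lemma prod_sample_index:
  "(\<Prod>(j, i)\<in>sample_index d n. g j i) = (\<Prod>j\<in>{1..d}. \<Prod>i\<in>{1..n j}. g j i)"
  unfolding sample_index_def by (rule prod.Sigma[symmetric]) auto

definition jump_law :: "nat \<Rightarrow> (nat \<Rightarrow> real measure) \<Rightarrow> nat \<Rightarrow> (nat \<times> nat \<Rightarrow> real) measure" where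
  "jump_law d H M = (\<Pi>\<^sub>M (j, m)\<in>{1..d} \<times> {1..M}. H j)"

text \<open>Probability that, given \<open>M\<close> atoms, observation \<open>x\<close> sits on atom \<open>f x\<close> for all \<open>x\<close>.\<close>

definition label_prob ::
    "nat \<Rightarrow> (nat \<Rightarrow> nat) \<Rightarrow> (nat \<Rightarrow> real measure) \<Rightarrow> nat \<Rightarrow> (nat \<times> nat \<Rightarrow> nat) \<Rightarrow> ennreal" where
  "label_prob d n H M f =
     (\<integral>\<^sup>+S. (\<Prod>(j, i)\<in>sample_index d n. ennreal (S (j, f (j, i)) / (\<Sum>m\<in>{1..M}. S (j, m)))) \<partial>jump_law d H M)"

definition label_count :: "(nat \<Rightarrow> nat) \<Rightarrow> (nat \<times> nat \<Rightarrow> nat) \<Rightarrow> nat \<Rightarrow> nat \<Rightarrow> nat" where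
  "label_count n f j m = card {i \<in> {1..n j}. f (j, i) = m}"

text \<open>The jump laws are constrained for every \<open>j\<close>, not only for the
  \<open>d\<close> groups, because the library's product locales ask for a family that is
  sigma-finite over the whole index type.\<close>

locale jump_distributions =
  fixes d :: nat and n :: "nat \<Rightarrow> nat" and H :: "nat \<Rightarrow> real measure"
  assumes n: "\<And>j. j \<in> {1..d} \<Longrightarrow> n j \<ge> 1"
    and prob_H: "\<And>j. prob_space (H j)"
    and sets_H: "\<And>j. sets (H j) = sets (restrict_space borel {0<..})"
begin

lemma space_H: "space (H j) = {0<..}"
  using sets_eq_imp_space_eq[OF sets_H, of j] by (simp add: space_restrict_space)

lemma prob_space_jump_law: "prob_space (jump_law d H M)"
  unfolding jump_law_def by (rule prob_space_PiM) (auto intro: prob_H)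

lemma jump_pos: "S \<in> space (jump_law d H M) \<Longrightarrow> j \<in> {1..d} \<Longrightarrow> m \<in> {1..M} \<Longrightarrow> S (j, m) > 0"
  by (auto simp: jump_law_def space_PiM PiE_iff space_H split: prod.splits)

lemma measurable_id_H: "(\<lambda>s. s) \<in> borel_measurable (H j)"
  by (subst measurable_cong_sets[OF sets_H refl]) (auto intro: measurable_restrict_space1)

lemma measurable_jump:
  assumes "j \<in> {1..d}" "m \<in> {1..M}"
  shows "(\<lambda>S. S (j, m)) \<in> borel_measurable (jump_law d H M)"
proof -
  have "(\<lambda>S. S (j, m)) \<in> jump_law d H M \<rightarrow>\<^sub>M H j"
    using measurable_component_singleton[of "(j, m)" "{1..d} \<times> {1..M}" "\<lambda>(j, m). H j"] assms
    by (simp add: jump_law_def)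
  from measurable_compose[OF this measurable_id_H] show ?thesis .
qed

lemma total_jump_pos:
  assumes "S \<in> space (jump_law d H M)" "j \<in> {1..d}" "M \<ge> 1"
  shows "(\<Sum>m\<in>{1..M}. S (j, m)) > 0"
  using assms by (intro sum_pos) (auto simp: jump_pos)

text \<open>Only the normalization couples the jumps. Writing each power of \<open>1 / T\<close> as
  a gamma integral turns it into \<open>exp (- u * T)\<close>, which is a product over the atoms;
  after exchanging integrals, independence gives one \<open>kappa\<close> per jump.\<close>

lemma label_prob_eq_integral:
  assumes M: "M \<ge> 1" and f: "f \<in> sample_index d n \<rightarrow>\<^sub>E {1..M}"
  shows "label_prob d n H M f =
    (\<integral>\<^sup>+u. (\<Prod>j\<in>{1..d}. indicator {0<..} (u j) *
        ennreal (u j ^ (n j - 1) / Gamma (real (n j)) * (\<Prod>m\<in>{1..M}. kappa (H j) (u j) (label_count n f j m))))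
      \<partial>(\<Pi>\<^sub>M j\<in>{1..d}. lborel))"
proof -
  interpret L: product_sigma_finite "\<lambda>_::nat. lborel :: real measure" by standard
  interpret HH: product_sigma_finite "\<lambda>(j, m::nat). H j"
    using prob_H by (auto simp: product_sigma_finite_def intro: prob_space_imp_sigma_finite)
  interpret J: prob_space "jump_law d H M" by (rule prob_space_jump_law)
  let ?e = "label_count n f"
  let ?L = "\<Pi>\<^sub>M j\<in>{1..d}. (lborel :: real measure)"
  interpret LL: sigma_finite_measure ?L by (rule L.sigma_finite) simp
  interpret JL: pair_sigma_finite "jump_law d H M" ?L by standard
  \<comment> \<open>\<open>a\<close> is the gamma weight of group \<open>j\<close> and
    \<open>g\<close> is the contribution of a single jump, with its share of
    \<open>exp (- v * T)\<close>.\<close>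
  define a where "a j v = indicator {0<..} v * ennreal (v ^ (n j - 1) / Gamma (real (n j)))" for j v
  define g where "g j v m s = ennreal (exp (- v * s) * s ^ ?e j m)" for j v m s
  have [measurable]: "a j \<in> borel_measurable borel" for j unfolding a_def by measurable
  have g_meas: "g j v m \<in> borel_measurable (H j)" for j v m
    unfolding g_def using measurable_id_H[of j] by measurable
  have g_meas1 [measurable]: "(\<lambda>v. g j v m s) \<in> borel_measurable borel" for j m s unfolding g_def by measurable
  \<comment> \<open>For fixed jumps, the product of the one-dimensional gamma integrals over the
    groups is one integral over the product space.\<close>
  have step1: "(\<Prod>(j, i)\<in>sample_index d n. ennreal (S (j, f (j, i)) / (\<Sum>m\<in>{1..M}. S (j, m))))
      = (\<integral>\<^sup>+u. (\<Prod>j\<in>{1..d}. a j (u j) * (\<Prod>m\<in>{1..M}. g j (u j) m (S (j, m)))) \<partial>?L)"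
    if S: "S \<in> space (jump_law d H M)" for S
  proof -
    define T where "T j = (\<Sum>m\<in>{1..M}. S (j, m))" for j
    have T: "T j > 0" if "j \<in> {1..d}" for j using total_jump_pos[OF S that M] by (simp add: T_def)
    have "(\<Prod>i\<in>{1..n j}. ennreal (S (j, f (j, i)) / T j))
        = (\<integral>\<^sup>+v. a j v * (\<Prod>m\<in>{1..M}. g j v m (S (j, m))) \<partial>lborel)" if j: "j \<in> {1..d}" for j
    proof -
      have fj: "f (j, i) \<in> {1..M}" if "i \<in> {1..n j}" for i
        using f j that by (auto simp: sample_index_def PiE_iff)
      \<comment> \<open>Observations are grouped by the atom they sit on, so each jump appears to
        the power of its count.\<close>
      have "(\<Prod>i\<in>{1..n j}. S (j, f (j, i))) = (\<Prod>m\<in>{1..M}. \<Prod>i\<in>{i \<in> {1..n j}. f (j, i) = m}. S (j, f (j, i)))"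
        using fj by (intro prod.group[symmetric]) auto
      also have "\<dots> = (\<Prod>m\<in>{1..M}. S (j, m) ^ ?e j m)"
        by (intro prod.cong refl) (simp add: label_count_def)
      finally have eq: "(\<Prod>i\<in>{1..n j}. S (j, f (j, i))) = (\<Prod>m\<in>{1..M}. S (j, m) ^ ?e j m)" (is "_ = ?Q") .
      have Q: "?Q \<ge> 0" using jump_pos[OF S j] by (intro prod_nonneg) (auto intro: less_imp_le)
      have "(\<Prod>i\<in>{1..n j}. ennreal (S (j, f (j, i)) / T j)) = ennreal (\<Prod>i\<in>{1..n j}. S (j, f (j, i)) / T j)"
        using T[OF j] jump_pos[OF S j fj] by (intro prod_ennreal) (auto simp: less_imp_le)
      also have "(\<Prod>i\<in>{1..n j}. S (j, f (j, i)) / T j) = ?Q * (1 / T j ^ n j)"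
        unfolding prod_dividef eq by simp
      also have "ennreal (?Q * (1 / T j ^ n j)) = ennreal ?Q * ennreal (1 / T j ^ n j)"
        using Q T[OF j] by (intro ennreal_mult) auto
      also have "\<dots> = ennreal ?Q * (\<integral>\<^sup>+v. indicator {0<..} v * ennreal (v ^ (n j - 1) / Gamma (real (n j)) * exp (- v * T j)) \<partial>lborel)"
        using nn_integral_gamma_kernel[OF n[OF j] T[OF j]] by simp
      also have "\<dots> = (\<integral>\<^sup>+v. ennreal ?Q * (indicator {0<..} v * ennreal (v ^ (n j - 1) / Gamma (real (n j)) * exp (- v * T j))) \<partial>lborel)"
        by (intro nn_integral_cmult[symmetric]) measurable
      also have "\<dots> = (\<integral>\<^sup>+v. a j v * (\<Prod>m\<in>{1..M}. g j v m (S (j, m))) \<partial>lborel)"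
      proof (rule nn_integral_cong)
        fix v :: real
        show "ennreal ?Q * (indicator {0<..} v * ennreal (v ^ (n j - 1) / Gamma (real (n j)) * exp (- v * T j)))
          = a j v * (\<Prod>m\<in>{1..M}. g j v m (S (j, m)))"
        proof (cases "v > 0")
          case True
          have "(\<Prod>m\<in>{1..M}. g j v m (S (j, m))) = ennreal (\<Prod>m\<in>{1..M}. exp (- v * S (j, m)) * S (j, m) ^ ?e j m)"
            unfolding g_def using jump_pos[OF S j] by (intro prod_ennreal) (auto simp: less_imp_le)
          also have "(\<Prod>m\<in>{1..M}. exp (- v * S (j, m)) * S (j, m) ^ ?e j m) = exp (- v * T j) * ?Q"
            by (simp add: prod.distrib T_def exp_sum[symmetric] sum_distrib_left sum_negf)
          finally have G: "(\<Prod>m\<in>{1..M}. g j v m (S (j, m))) = ennreal (exp (- v * T j) * ?Q)" .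
          have c: "v ^ (n j - 1) / Gamma (real (n j)) \<ge> 0" using True n[OF j] by simp
          have perm: "ennreal x * ennreal (y * z) = ennreal y * ennreal (z * x)"
            if "x \<ge> 0" "y \<ge> 0" "z \<ge> 0" for x y z
            using that by (simp add: ennreal_mult mult_ac)
          have "ennreal ?Q * ennreal (v ^ (n j - 1) / Gamma (real (n j)) * exp (- v * T j))
              = ennreal (v ^ (n j - 1) / Gamma (real (n j))) * (\<Prod>m\<in>{1..M}. g j v m (S (j, m)))"
            unfolding G by (rule perm[OF Q c exp_ge_zero])
          then show ?thesis using True by (simp add: a_def)
        qed (simp add: a_def)
      qed
      finally show ?thesis .
    qed
    then have "(\<Prod>(j, i)\<in>sample_index d n. ennreal (S (j, f (j, i)) / (\<Sum>m\<in>{1..M}. S (j, m))))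
      = (\<Prod>j\<in>{1..d}. \<integral>\<^sup>+v. a j v * (\<Prod>m\<in>{1..M}. g j v m (S (j, m))) \<partial>lborel)"
      by (simp add: prod_sample_index T_def)
    also have "\<dots> = (\<integral>\<^sup>+u. (\<Prod>j\<in>{1..d}. a j (u j) * (\<Prod>m\<in>{1..M}. g j (u j) m (S (j, m)))) \<partial>?L)"
      by (intro L.product_nn_integral_prod[symmetric]) measurable
    finally show ?thesis .
  qed
  have meas: "(\<lambda>(S, u). \<Prod>j\<in>{1..d}. a j (u j) * (\<Prod>m\<in>{1..M}. g j (u j) m (S (j, m))))
      \<in> borel_measurable (jump_law d H M \<Otimes>\<^sub>M ?L)"
  proof -
    have 1: "(\<lambda>x. fst x (j, m)) \<in> borel_measurable (jump_law d H M \<Otimes>\<^sub>M ?L)" if "j \<in> {1..d}" "m \<in> {1..M}" for j m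
      using measurable_compose[OF measurable_fst measurable_jump[OF that]] .
    have 2: "(\<lambda>x. snd x j) \<in> borel_measurable (jump_law d H M \<Otimes>\<^sub>M ?L)" if "j \<in> {1..d}" for j
      using measurable_compose[OF measurable_snd measurable_component_singleton[OF that, of "\<lambda>_. lborel"]] by simp
    have 3: "(\<lambda>x. a j (snd x j)) \<in> borel_measurable (jump_law d H M \<Otimes>\<^sub>M ?L)" if "j \<in> {1..d}" for j
      by (rule measurable_compose[OF 2[OF that]]) measurable
    have 4: "(\<lambda>x. g j (snd x j) m (fst x (j, m))) \<in> borel_measurable (jump_law d H M \<Otimes>\<^sub>M ?L)"
      if "j \<in> {1..d}" "m \<in> {1..M}" for j m
      unfolding g_def using 1[OF that] 2[OF that(1)] by measurable
    show ?thesis unfolding split_beta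
      using 3 4 by (intro borel_measurable_prod_ennreal borel_measurable_times_ennreal) auto
  qed
  \<comment> \<open>For fixed \<open>u\<close>, the integrand is a product of functions of distinct
    independent jumps.\<close>
  have step2: "(\<integral>\<^sup>+S. (\<Prod>j\<in>{1..d}. a j (u j) * (\<Prod>m\<in>{1..M}. g j (u j) m (S (j, m)))) \<partial>jump_law d H M)
      = (\<Prod>j\<in>{1..d}. indicator {0<..} (u j) *
        ennreal (u j ^ (n j - 1) / Gamma (real (n j)) * (\<Prod>m\<in>{1..M}. kappa (H j) (u j) (?e j m))))" for u
  proof -
    have "(\<integral>\<^sup>+S. (\<Prod>j\<in>{1..d}. a j (u j) * (\<Prod>m\<in>{1..M}. g j (u j) m (S (j, m)))) \<partial>jump_law d H M)
      = (\<integral>\<^sup>+S. (\<Prod>j\<in>{1..d}. a j (u j)) * (\<Prod>x\<in>{1..d} \<times> {1..M}. (case x of (j, m) \<Rightarrow> g j (u j) m) (S x)) \<partial>jump_law d H M)"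
      by (simp add: prod.distrib prod.cartesian_product split_beta)
    also have "\<dots> = (\<Prod>j\<in>{1..d}. a j (u j)) * (\<integral>\<^sup>+S. (\<Prod>x\<in>{1..d} \<times> {1..M}. (case x of (j, m) \<Rightarrow> g j (u j) m) (S x)) \<partial>jump_law d H M)"
    proof (rule nn_integral_cmult)
      have "(\<lambda>S. g j (u j) m (S (j, m))) \<in> borel_measurable (jump_law d H M)" if "j \<in> {1..d}" "m \<in> {1..M}" for j m
        unfolding g_def using measurable_jump[OF that] by measurable
      then show "(\<lambda>S. \<Prod>x\<in>{1..d} \<times> {1..M}. (case x of (j, m) \<Rightarrow> g j (u j) m) (S x)) \<in> borel_measurable (jump_law d H M)"
        by (intro borel_measurable_prod_ennreal) auto
    qed
    also have "(\<integral>\<^sup>+S. (\<Prod>x\<in>{1..d} \<times> {1..M}. (case x of (j, m) \<Rightarrow> g j (u j) m) (S x)) \<partial>jump_law d H M)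
      = (\<Prod>x\<in>{1..d} \<times> {1..M}. integral\<^sup>N (case x of (j, m) \<Rightarrow> H j) (case x of (j, m) \<Rightarrow> g j (u j) m))"
      unfolding jump_law_def using g_meas by (intro HH.product_nn_integral_prod) (auto split: prod.splits)
    also have "\<dots> = (\<Prod>j\<in>{1..d}. \<Prod>m\<in>{1..M}. \<integral>\<^sup>+s. g j (u j) m s \<partial>H j)"
      by (simp add: prod.cartesian_product split_beta)
    also have "(\<Prod>j\<in>{1..d}. a j (u j)) * \<dots> = (\<Prod>j\<in>{1..d}. a j (u j) * (\<Prod>m\<in>{1..M}. \<integral>\<^sup>+s. g j (u j) m s \<partial>H j))"
      by (simp add: prod.distrib)
    also have "\<dots> = (\<Prod>j\<in>{1..d}. indicator {0<..} (u j) *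
        ennreal (u j ^ (n j - 1) / Gamma (real (n j)) * (\<Prod>m\<in>{1..M}. kappa (H j) (u j) (?e j m))))"
    proof (rule prod.cong[OF refl])
      fix j assume j: "j \<in> {1..d}"
      show "a j (u j) * (\<Prod>m\<in>{1..M}. \<integral>\<^sup>+s. g j (u j) m s \<partial>H j) = indicator {0<..} (u j) *
        ennreal (u j ^ (n j - 1) / Gamma (real (n j)) * (\<Prod>m\<in>{1..M}. kappa (H j) (u j) (?e j m)))"
      proof (cases "u j > 0")
        case True
        have kp: "kappa (H j) (u j) r \<ge> 0" for r
          using kappa_pos[OF prob_H sets_H True] by (rule less_imp_le)
        have "(\<Prod>m\<in>{1..M}. \<integral>\<^sup>+s. g j (u j) m s \<partial>H j) = ennreal (\<Prod>m\<in>{1..M}. kappa (H j) (u j) (?e j m))"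
          unfolding g_def by (simp add: nn_integral_kappa[OF prob_H sets_H True, simplified] prod_ennreal kp)
        moreover have "u j ^ (n j - 1) / Gamma (real (n j)) \<ge> 0" using True n[OF j] by simp
        moreover have "(\<Prod>m\<in>{1..M}. kappa (H j) (u j) (?e j m)) \<ge> 0" using kp by (intro prod_nonneg) auto
        ultimately show ?thesis using True by (simp add: a_def ennreal_mult[symmetric])
      qed (simp add: a_def)
    qed
    finally show ?thesis .
  qed
  have "label_prob d n H M f = (\<integral>\<^sup>+S. (\<integral>\<^sup>+u. (\<Prod>j\<in>{1..d}. a j (u j) * (\<Prod>m\<in>{1..M}. g j (u j) m (S (j, m)))) \<partial>?L) \<partial>jump_law d H M)"
    unfolding label_prob_def by (rule nn_integral_cong) (rule step1)
  \<comment> \<open>Tonelli: the jumps are averaged first, with \<open>u\<close> held fixed.\<close>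
  also have "\<dots> = (\<integral>\<^sup>+u. (\<integral>\<^sup>+S. (\<Prod>j\<in>{1..d}. a j (u j) * (\<Prod>m\<in>{1..M}. g j (u j) m (S (j, m)))) \<partial>jump_law d H M) \<partial>?L)"
    by (rule JL.Fubini'[OF meas, symmetric])
  finally show ?thesis unfolding step2 .
qed

end

subsection \<open>The law of the sample\<close>

text \<open>\<open>distr\<close> always goes through \<open>measure_of\<close>, whose value is
  either the mass of a preimage or 0. This covers arbitrary \<open>f\<close>.\<close>

lemma emeasure_distr_le_1:
  assumes "prob_space M"
  shows "emeasure (distr M N f) A \<le> 1"
proof -
  interpret prob_space M by fact
  show ?thesis unfolding distr_def by (auto simp: emeasure_measure_of_conv intro: measure_le_1)
qed

text \<open>If the set function \<open>A \<mapsto> M (f -` A)\<close> fails to be a measure, \<open>distr\<close> is the null measure. This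
  matters for the summand \<open>M = 0\<close> in \<open>vec_nifpp\<close>, where \<open>normalized\<close> is not a probability.\<close>

lemma distr_in_subprob_algebra:
  assumes "prob_space M" "space N \<noteq> {}"
  shows "distr M N f \<in> space (subprob_algebra N)"
  using emeasure_distr_le_1[OF assms(1)] assms(2)
  by (auto simp: space_subprob_algebra intro!: subprob_spaceI)

text \<open>Supplies the candidate law of the sample as a genuine measure, so that it can later be
  compared with the true law on rectangles only. It is the bind of the kernels \<open>D M f\<close>
  over pairs \<open>(M, f)\<close> with the given weights.\<close>

lemma mixture_measure_exists:
  fixes q :: "nat pmf" and D :: "nat \<Rightarrow> 'b \<Rightarrow> 'c measure" and w :: "nat \<Rightarrow> 'b \<Rightarrow> ennreal"
  assumes D: "\<And>M f. D M f \<in> space (subprob_algebra N)" and F: "\<And>M. finite (F M)"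
  shows "\<exists>\<nu>. sets \<nu> = sets N \<and>
    (\<forall>A\<in>sets N. emeasure \<nu> A = (\<integral>\<^sup>+M. (\<Sum>f\<in>F M. w M f * emeasure (D M f) A) \<partial>measure_pmf q))"
proof (intro exI conjI ballI)
  define \<omega> where "\<omega> = (\<lambda>(M, f). ennreal (pmf q M) * (if f \<in> F M then w M f else 0))"
  \<comment> \<open>All sets of pairs are measurable, so measurability of the kernel in
    \<open>(M, f)\<close> is automatic.\<close>
  define B where "B = density (count_space UNIV) \<omega>"
  define \<nu> where "\<nu> = B \<bind> (\<lambda>(M, f). D M f)"
  have B: "space B = UNIV" "sets B = UNIV" by (auto simp: B_def)
  have D': "(\<lambda>(M, f). D M f) \<in> B \<rightarrow>\<^sub>M subprob_algebra N"
    using D by (auto simp: measurable_def B)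
  show "sets \<nu> = sets N"
    unfolding \<nu>_def using D by (intro sets_bind) (auto simp: B space_subprob_algebra)
  fix A assume A: "A \<in> sets N"
  have "emeasure \<nu> A = (\<integral>\<^sup>+x. emeasure (case x of (M, f) \<Rightarrow> D M f) A \<partial>B)"
    unfolding \<nu>_def using D' A by (intro emeasure_bind) (auto simp: B)
  also have "\<dots> = (\<integral>\<^sup>+x. \<omega> x * emeasure (case x of (M, f) \<Rightarrow> D M f) A \<partial>count_space UNIV)"
    unfolding B_def by (intro nn_integral_density) auto
  also have "\<dots> = (\<integral>\<^sup>+M. \<integral>\<^sup>+f. ennreal (pmf q M) * ((if f \<in> F M then w M f else 0) * emeasure (D M f) A)
      \<partial>count_space UNIV \<partial>count_space UNIV)"
    by (subst nn_integral_fst_count_space[symmetric]) (simp add: \<omega>_def mult.assoc)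
  also have "\<dots> = (\<integral>\<^sup>+M. ennreal (pmf q M) * (\<Sum>f\<in>F M. w M f * emeasure (D M f) A) \<partial>count_space UNIV)"
  proof (rule nn_integral_cong)
    fix M
    have "(\<integral>\<^sup>+f. (if f \<in> F M then w M f else 0) * emeasure (D M f) A \<partial>count_space UNIV)
        = (\<Sum>f\<in>F M. (if f \<in> F M then w M f else 0) * emeasure (D M f) A)"
      using F by (intro nn_integral_count_space') auto
    then show "(\<integral>\<^sup>+f. ennreal (pmf q M) * ((if f \<in> F M then w M f else 0) * emeasure (D M f) A) \<partial>count_space UNIV)
        = ennreal (pmf q M) * (\<Sum>f\<in>F M. w M f * emeasure (D M f) A)"
      by (simp add: nn_integral_cmult)
  qed
  also have "\<dots> = (\<integral>\<^sup>+M. (\<Sum>f\<in>F M. w M f * emeasure (D M f) A) \<partial>measure_pmf q)"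
    by (simp add: nn_integral_measure_pmf)
  finally show "emeasure \<nu> A = (\<integral>\<^sup>+M. (\<Sum>f\<in>F M. w M f * emeasure (D M f) A) \<partial>measure_pmf q)" .
qed

section \<open>Ties of samples built from independent draws of a diffuse measure\<close>

text \<open>For two coordinates, integrate one of them first with the other held fixed: the
  coincidence event has a singleton as its section, which is null by diffuseness. There are only
  finitely many pairs.\<close>

lemma AE_distinct_PiM:
  fixes P :: "'a measure"
  assumes P: "prob_space P" and diag: "Measurable.pred (P \<Otimes>\<^sub>M P) (\<lambda>(x, y). x = y)"
    and diffuse: "\<And>x. x \<in> space P \<Longrightarrow> emeasure P {x} = 0" and I: "finite I"
  shows "AE t in (\<Pi>\<^sub>M i\<in>I. P). inj_on t I"
proof -
  interpret prob_space P by fact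
  interpret product_prob_space "\<lambda>_. P" I by standard
  have "AE t in (\<Pi>\<^sub>M i\<in>I. P). t i \<noteq> t j" if ij: "i \<in> I" "j \<in> I" "i \<noteq> j" for i j
  proof -
    let ?J = "I - {i}"
    have I_eq: "I = insert i ?J" using ij by auto
    have m: "Measurable.pred (\<Pi>\<^sub>M i\<in>I. P) (\<lambda>t. t i = t j)"
      using measurable_compose[OF measurable_Pair[OF measurable_component_singleton[OF ij(1)] measurable_component_singleton[OF ij(2)]] diag]
      by simp
    then have S: "{t \<in> space (\<Pi>\<^sub>M i\<in>I. P). t i = t j} \<in> sets (\<Pi>\<^sub>M i\<in>I. P)" (is "?S \<in> _") by simp
    have "emeasure (\<Pi>\<^sub>M i\<in>I. P) ?S = (\<integral>\<^sup>+t. indicator ?S t \<partial>(\<Pi>\<^sub>M i\<in>I. P))" using S by simp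
    also have "\<dots> = (\<integral>\<^sup>+t. indicator ?S t \<partial>(\<Pi>\<^sub>M i\<in>insert i ?J. P))" using I_eq by simp
    also have "\<dots> = (\<integral>\<^sup>+t. \<integral>\<^sup>+y. indicator ?S (t(i := y)) \<partial>P \<partial>(\<Pi>\<^sub>M i\<in>?J. P))"
    proof (rule product_nn_integral_insert)
      show "indicator ?S \<in> borel_measurable (\<Pi>\<^sub>M i\<in>insert i ?J. P)" using S I_eq by simp
    qed (use I in auto)
    also have "\<dots> = (\<integral>\<^sup>+t. 0 \<partial>(\<Pi>\<^sub>M i\<in>?J. P))"
    proof (rule nn_integral_cong)
      fix t assume t: "t \<in> space (\<Pi>\<^sub>M i\<in>?J. P)"
      have tj: "t j \<in> space P" using t ij by (auto simp: space_PiM PiE_iff)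
      \<comment> \<open>Measurability of a singleton is obtained as a section of the measurable
        diagonal.\<close>
      have "{x \<in> space P. t j = x} \<in> sets P"
        using measurable_compose[OF measurable_Pair1'[OF tj] diag] by (simp add: pred_def)
      moreover have "{x \<in> space P. t j = x} = {t j}" using tj by auto
      ultimately have sj: "{t j} \<in> sets P" by simp
      have "(\<integral>\<^sup>+y. indicator ?S (t(i := y)) \<partial>P) = (\<integral>\<^sup>+y. indicator {t j} y \<partial>P)"
        using t ij by (intro nn_integral_cong) (auto simp: indicator_def space_PiM PiE_iff extensional_def)
      also have "\<dots> = 0" using sj diffuse[OF tj] by simp
      finally show "(\<integral>\<^sup>+y. indicator ?S (t(i := y)) \<partial>P) = 0" .
    qed
    finally show ?thesis using S by (intro AE_I[of _ _ ?S]) auto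
  qed
  then have "AE t in (\<Pi>\<^sub>M i\<in>I. P). \<forall>i\<in>I. \<forall>j\<in>I. i \<noteq> j \<longrightarrow> t i \<noteq> t j"
    using I by (intro AE_finite_allI) auto
  then show ?thesis by eventually_elim (auto simp: inj_on_def)
qed

text \<open>The law of the sample given the labeling \<open>f\<close>: independent atoms drawn from
  \<open>B\<close>, with each index reading off the atom it is assigned to.\<close>

definition tied_law :: "nat set \<Rightarrow> 'i set \<Rightarrow> 'a measure \<Rightarrow> ('i \<Rightarrow> nat) \<Rightarrow> ('i \<Rightarrow> 'a) measure" where
  "tied_law J I B f = distr (\<Pi>\<^sub>M m\<in>J. B) (\<Pi>\<^sub>M x\<in>I. B) (\<lambda>t. \<lambda>x\<in>I. t (f x))"

lemma measurable_relabel: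
  assumes "f \<in> I \<rightarrow> J"
  shows "(\<lambda>t. \<lambda>x\<in>I. t (f x)) \<in> (\<Pi>\<^sub>M m\<in>J. B) \<rightarrow>\<^sub>M (\<Pi>\<^sub>M x\<in>I. B)"
  using assms by (intro measurable_restrict measurable_component_singleton) auto

lemma emeasure_tied_law_PiE:
  assumes f: "f \<in> I \<rightarrow> J" and I: "finite I" and A: "\<And>x. x \<in> I \<Longrightarrow> A x \<in> sets B"
  shows "emeasure (tied_law J I B f) (PiE I A) = (\<integral>\<^sup>+t. (\<Prod>x\<in>I. indicator (A x) (t (f x))) \<partial>(\<Pi>\<^sub>M m\<in>J. B))"
proof -
  have S: "PiE I A \<in> sets (\<Pi>\<^sub>M x\<in>I. B)" using I A by (intro sets_PiM_I_finite) auto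
  have "emeasure (tied_law J I B f) (PiE I A) = (\<integral>\<^sup>+y. indicator (PiE I A) y \<partial>tied_law J I B f)"
    using S by (simp add: tied_law_def)
  also have "\<dots> = (\<integral>\<^sup>+t. indicator (PiE I A) (\<lambda>x\<in>I. t (f x)) \<partial>(\<Pi>\<^sub>M m\<in>J. B))"
    unfolding tied_law_def using S by (intro nn_integral_distr measurable_relabel[OF f]) auto
  also have "\<dots> = (\<integral>\<^sup>+t. (\<Prod>x\<in>I. indicator (A x) (t (f x))) \<partial>(\<Pi>\<^sub>M m\<in>J. B))"
  proof (rule nn_integral_cong)
    fix t show "indicator (PiE I A) (\<lambda>x\<in>I. t (f x)) = (\<Prod>x\<in>I. indicator (A x) (t (f x)) :: ennreal)"
    proof (cases "\<forall>x\<in>I. t (f x) \<in> A x")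
      case False
      then obtain x where x: "x \<in> I" "t (f x) \<notin> A x" by auto
      then have "(\<Prod>x\<in>I. indicator (A x) (t (f x)) :: ennreal) = 0" using I by (intro prod_zero bexI[of _ x]) auto
      with x show ?thesis by (auto simp: PiE_iff indicator_def)
    qed (auto simp: PiE_iff)
  qed
  finally show ?thesis .
qed

text \<open>The atoms are almost surely distinct, so the ties of the sample are those of
  \<open>f\<close> and are no longer random; the probability is 0 or 1.\<close>

lemma emeasure_tied_law_tie_partition:
  fixes B :: "'a measure"
  assumes B: "prob_space B" and diag: "Measurable.pred (B \<Otimes>\<^sub>M B) (\<lambda>(x, y). x = y)"
    and diffuse: "\<And>x. x \<in> space B \<Longrightarrow> emeasure B {x} = 0" and J: "finite J"
    and f: "f \<in> I \<rightarrow> J"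
    and E: "{y \<in> space (\<Pi>\<^sub>M x\<in>I. B). tie_partition I y = Q} \<in> sets (\<Pi>\<^sub>M x\<in>I. B)"
  shows "emeasure (tied_law J I B f) {y \<in> space (\<Pi>\<^sub>M x\<in>I. B). tie_partition I y = Q} = indicator {f. tie_partition I f = Q} f"
    (is "emeasure _ ?E = _")
proof -
  interpret PP: prob_space "\<Pi>\<^sub>M m\<in>J. B" by (rule prob_space_PiM) (rule B)
  note m = measurable_relabel[OF f, of B]
  have "emeasure (tied_law J I B f) ?E = (\<integral>\<^sup>+t. indicator ?E (\<lambda>x\<in>I. t (f x)) \<partial>(\<Pi>\<^sub>M m\<in>J. B))"
    using E by (subst nn_integral_distr[OF m, symmetric]) (auto simp: tied_law_def)
  also have "\<dots> = (\<integral>\<^sup>+t. indicator {f. tie_partition I f = Q} f \<partial>(\<Pi>\<^sub>M m\<in>J. B))"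
  proof (rule nn_integral_cong_AE)
    have "AE t in (\<Pi>\<^sub>M m\<in>J. B). inj_on t J" using AE_distinct_PiM[OF B diag _ J] diffuse by simp
    from this AE_space
    show "AE t in (\<Pi>\<^sub>M m\<in>J. B). indicator ?E (\<lambda>x\<in>I. t (f x)) = (indicator {f. tie_partition I f = Q} f :: ennreal)"
    proof eventually_elim
      case (elim t)
      have "tie_partition I (\<lambda>x\<in>I. t (f x)) = tie_partition I f"
        using elim f by (auto simp: tie_partition_eq_iff dest: inj_onD)
      then show ?case using measurable_space[OF m elim(2)] by (simp add: indicator_def)
    qed
  qed
  also have "\<dots> = indicator {f. tie_partition I f = Q} f" by (simp add: PP.emeasure_space_1)
  finally show ?thesis .
qed

text \<open>The event is a finite Boolean combination of coincidences of two coordinates, each the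
  preimage of the measurable diagonal.\<close>

lemma sets_tie_partition:
  fixes B :: "'a measure"
  assumes diag: "Measurable.pred (B \<Otimes>\<^sub>M B) (\<lambda>(x, y). x = y)" and I: "finite I"
  shows "{y \<in> space (\<Pi>\<^sub>M x\<in>I. B). tie_partition I y = tie_partition I b} \<in> sets (\<Pi>\<^sub>M x\<in>I. B)"
proof -
  have [measurable]: "Measurable.pred (\<Pi>\<^sub>M x\<in>I. B) (\<lambda>y. y a = y b)" if "a \<in> I" "b \<in> I" for a b
    using measurable_compose[OF measurable_Pair[OF measurable_component_singleton[OF that(1)] measurable_component_singleton[OF that(2)]] diag]
    by simp
  have "Measurable.pred (\<Pi>\<^sub>M x\<in>I. B) (\<lambda>y. \<forall>a\<in>I. \<forall>c\<in>I. y a = y c \<longleftrightarrow> b a = b c)"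
    using I by (intro pred_intros_finite) auto
  then show ?thesis unfolding tie_partition_eq_iff by (simp add: pred_def)
qed

section \<open>From the conditional law of the sample to rectangle probabilities\<close>

lemma borel_measurable_prod_emeasure:
  assumes A: "\<And>x. x \<in> sample_index d n \<Longrightarrow> A x \<in> sets B"
  shows "(\<lambda>p. \<Prod>(j, i)\<in>sample_index d n. emeasure (p j) (A (j, i)))
    \<in> borel_measurable (\<Pi>\<^sub>M j\<in>{1..d}. prob_algebra B)"
  unfolding split_beta
proof (rule borel_measurable_prod_ennreal)
  fix x assume x: "x \<in> sample_index d n"
  then have "(\<lambda>p. p (fst x)) \<in> (\<Pi>\<^sub>M j\<in>{1..d}. prob_algebra B) \<rightarrow>\<^sub>M subprob_algebra B"
    by (intro measurable_prob_algebraD measurable_component_singleton) (auto simp: sample_index_def)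
  from measurable_compose[OF this measurable_emeasure_subprob_algebra[OF A[OF x]]]
  show "(\<lambda>p. emeasure (p (fst x)) (A (fst x, snd x))) \<in> borel_measurable (\<Pi>\<^sub>M j\<in>{1..d}. prob_algebra B)"
    by simp
qed

text \<open>Integrating the conditional probability gives the probability. The conditional
  probability depends on \<open>w\<close> only through \<open>P w\<close>, so the integral is one
  against the law of \<open>P\<close>.\<close>

lemma emeasure_conditional_sample:
  assumes W: "prob_space W" and S: "conditional_sample W B d n P \<theta>"
    and A: "\<And>x. x \<in> sample_index d n \<Longrightarrow> A x \<in> sets B"
  shows "emeasure W {w \<in> space W. \<forall>x\<in>sample_index d n. \<theta> x w \<in> A x}
    = (\<integral>\<^sup>+p. (\<Prod>(j, i)\<in>sample_index d n. emeasure (p j) (A (j, i)))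
        \<partial>distr W (\<Pi>\<^sub>M j\<in>{1..d}. prob_algebra B) P)"
proof -
  interpret prob_space W by fact
  let ?N = "\<Pi>\<^sub>M j\<in>{1..d}. prob_algebra B" and ?I = "sample_index d n"
  let ?F = "vimage_algebra (space W) P ?N"
  let ?E = "{w \<in> space W. \<forall>x\<in>?I. \<theta> x w \<in> A x}"
  from S have P: "P \<in> W \<rightarrow>\<^sub>M ?N" and \<theta>: "\<And>x. x \<in> ?I \<Longrightarrow> \<theta> x \<in> W \<rightarrow>\<^sub>M B"
    and ce: "AE w in W. real_cond_exp W ?F (indicator ?E) w = (\<Prod>(j, i)\<in>?I. measure (P w j) (A (j, i)))"
    using A unfolding conditional_sample_def by auto
  have "subalgebra W ?F"
    using P unfolding subalgebra_def by (auto simp: sets_vimage_algebra2 measurable_def)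
  then interpret finite_measure_subalgebra W ?F by unfold_locales
  have E: "?E \<in> sets W"
  proof -
    have "?E = {w \<in> space W. \<forall>x\<in>?I. w \<in> \<theta> x -` A x \<inter> space W}" by auto
    also have "\<dots> \<in> sets W" using \<theta> A by (intro sets.sets_Collect_finite_All) auto
    finally show ?thesis .
  qed
  have int: "integrable W (indicator ?E :: _ \<Rightarrow> real)" using E by (simp add: emeasure_eq_measure)
  have g: "(\<lambda>p. \<Prod>(j, i)\<in>?I. emeasure (p j) (A (j, i))) \<in> borel_measurable ?N"
    using A by (rule borel_measurable_prod_emeasure)
  have nn: "(\<Prod>(j, i)\<in>?I. measure (P w j) (A (j, i))) \<ge> 0" for w by (intro prod_nonneg) auto
  have "emeasure W ?E = ennreal (\<integral>w. real_cond_exp W ?F (indicator ?E) w \<partial>W)"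
    using real_cond_exp_int(2)[OF int] E by (simp add: emeasure_eq_measure)
  also have "\<dots> = (\<integral>\<^sup>+w. ennreal (real_cond_exp W ?F (indicator ?E) w) \<partial>W)"
  proof (rule nn_integral_eq_integral[symmetric, OF real_cond_exp_int(1)[OF int]])
    show "AE w in W. 0 \<le> real_cond_exp W ?F (indicator ?E) w" using ce by eventually_elim (simp add: nn)
  qed
  also have "\<dots> = (\<integral>\<^sup>+w. (\<Prod>(j, i)\<in>?I. emeasure (P w j) (A (j, i))) \<partial>W)"
  proof (rule nn_integral_cong_AE)
    from ce AE_space show "AE w in W. ennreal (real_cond_exp W ?F (indicator ?E) w) = (\<Prod>(j, i)\<in>?I. emeasure (P w j) (A (j, i)))"
    proof eventually_elim
      case (elim w)
      have "finite_measure (P w j)" if "j \<in> {1..d}" for j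
        using measurable_space[OF P elim(2)] that
        by (auto simp: space_PiM PiE_iff space_prob_algebra intro: prob_space.finite_measure)
      then have "(\<Prod>(j, i)\<in>?I. emeasure (P w j) (A (j, i))) = (\<Prod>(j, i)\<in>?I. ennreal (measure (P w j) (A (j, i))))"
        by (intro prod.cong refl) (auto simp: sample_index_def finite_measure.emeasure_eq_measure)
      also have "\<dots> = ennreal (\<Prod>(j, i)\<in>?I. measure (P w j) (A (j, i)))"
        by (simp add: split_beta prod_ennreal)
      finally show ?case using elim by simp
    qed
  qed
  also have "\<dots> = (\<integral>\<^sup>+p. (\<Prod>(j, i)\<in>?I. emeasure (p j) (A (j, i))) \<partial>distr W ?N P)"
    using g by (intro nn_integral_distr[OF P, symmetric]) simp
  finally show ?thesis .
qed

section \<open>The sample as a mixture over labelings\<close>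

context jump_distributions begin

lemma emeasure_normalized_discrete:
  assumes x: "x \<in> space (jump_law d H M \<Otimes>\<^sub>M (\<Pi>\<^sub>M m\<in>{1..M}. B))" and M: "M \<ge> 1"
    and j: "j \<in> {1..d}" and A: "A \<in> sets B"
  shows "emeasure (normalized (discrete_measure B M (\<lambda>m. fst x (j, m)) (snd x))) A
    = (\<Sum>m\<in>{1..M}. ennreal (fst x (j, m) / (\<Sum>m\<in>{1..M}. fst x (j, m))) * indicator A (snd x m))"
proof -
  define T where "T = (\<Sum>m\<in>{1..M}. fst x (j, m))"
  have S: "fst x \<in> space (jump_law d H M)" and t: "snd x m \<in> space B" if "m \<in> {1..M}" for m
    using x that by (auto simp: space_pair_measure space_PiM PiE_iff)
  then have S: "fst x \<in> space (jump_law d H M)" using M by auto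
  have T: "T > 0" using total_jump_pos[OF S j M] by (simp add: T_def)
  have em: "emeasure (discrete_measure B M (\<lambda>m. fst x (j, m)) (snd x)) A
      = (\<Sum>m\<in>{1..M}. ennreal (fst x (j, m)) * indicator A (snd x m))" if "A \<in> sets B" for A
    using t that by (subst emeasure_discrete_measure) auto
  have ss: "space (discrete_measure B M a b) = space B" for a b by (simp add: discrete_measure_def)
  have tot: "emeasure (discrete_measure B M (\<lambda>m. fst x (j, m)) (snd x)) (space B) = ennreal T"
    using jump_pos[OF S j] t unfolding T_def
    by (subst em, simp, subst sum_ennreal[symmetric]) (auto simp: less_imp_le intro!: sum.cong)
  have inv: "1 / ennreal T = ennreal (1 / T)"
    using T by (simp add: divide_ennreal ennreal_1[symmetric] del: ennreal_1)
  show ?thesis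
    unfolding normalized_def ss tot emeasure_scale_measure em[OF A] T_def[symmetric] inv sum_distrib_left
    using T jump_pos[OF S j]
    by (intro sum.cong refl) (simp add: mult.assoc[symmetric] ennreal_mult[symmetric] less_imp_le)
qed

text \<open>Expanding the product of discrete measures gives a sum over labelings. Each summand is a
  function of the jumps times a function of the atoms, and these are independent.\<close>

lemma nn_integral_prod_normalized_discrete:
  assumes B: "prob_space B" and M: "M \<ge> 1" and A: "\<And>x. x \<in> sample_index d n \<Longrightarrow> A x \<in> sets B"
  shows "(\<integral>\<^sup>+x. (\<Prod>(j, i)\<in>sample_index d n.
        emeasure (normalized (discrete_measure B M (\<lambda>m. fst x (j, m)) (snd x))) (A (j, i)))
      \<partial>(jump_law d H M \<Otimes>\<^sub>M (\<Pi>\<^sub>M m\<in>{1..M}. B)))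
    = (\<Sum>f\<in>sample_index d n \<rightarrow>\<^sub>E {1..M}. label_prob d n H M f *
        emeasure (tied_law {1..M} (sample_index d n) B f) (PiE (sample_index d n) A))"
proof -
  let ?I = "sample_index d n" and ?T = "\<Pi>\<^sub>M m\<in>{1..M}. B"
  interpret TT: prob_space ?T by (rule prob_space_PiM) (rule B)
  define w where "w f S = (\<Prod>(j, i)\<in>?I. ennreal (S (j, f (j, i)) / (\<Sum>m\<in>{1..M}. S (j, m))))" for f :: "nat \<times> nat \<Rightarrow> nat" and S :: "nat \<times> nat \<Rightarrow> real"
  define v where "v f t = (\<Prod>x\<in>?I. indicator (A x) (t (f x)) :: ennreal)" for f :: "nat \<times> nat \<Rightarrow> nat" and t
  have w: "w f \<in> borel_measurable (jump_law d H M)" if f: "f \<in> ?I \<rightarrow>\<^sub>E {1..M}" for f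
  proof -
    have "(\<lambda>S. ennreal (S (j, f (j, i)) / (\<Sum>m\<in>{1..M}. S (j, m)))) \<in> borel_measurable (jump_law d H M)"
      if ji: "(j, i) \<in> ?I" for j i
    proof -
      have j: "j \<in> {1..d}" and fm: "f (j, i) \<in> {1..M}" using ji f by (auto simp: sample_index_def PiE_iff)
      have [measurable]: "(\<lambda>S. \<Sum>m\<in>{1..M}. S (j, m)) \<in> borel_measurable (jump_law d H M)"
        by (rule borel_measurable_sum) (rule measurable_jump[OF j])
      note [measurable] = measurable_jump[OF j fm]
      show ?thesis by measurable
    qed
    then have "(\<lambda>S. ennreal (S (fst x, f (fst x, snd x)) / (\<Sum>m\<in>{1..M}. S (fst x, m)))) \<in> borel_measurable (jump_law d H M)"
      if "x \<in> ?I" for x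
      using that by (cases x) auto
    then show ?thesis unfolding w_def split_beta by (intro borel_measurable_prod_ennreal) simp
  qed
  have v: "v f \<in> borel_measurable ?T" if f: "f \<in> ?I \<rightarrow>\<^sub>E {1..M}" for f
    unfolding v_def
  proof (rule borel_measurable_prod_ennreal)
    fix x assume x: "x \<in> ?I"
    then have "f x \<in> {1..M}" using f by auto
    from measurable_compose[OF measurable_component_singleton[OF this] borel_measurable_indicator[OF A[OF x]]]
    show "(\<lambda>t. indicator (A x) (t (f x)) :: ennreal) \<in> borel_measurable ?T" .
  qed
  have "(\<integral>\<^sup>+x. (\<Prod>(j, i)\<in>?I. emeasure (normalized (discrete_measure B M (\<lambda>m. fst x (j, m)) (snd x))) (A (j, i)))
      \<partial>(jump_law d H M \<Otimes>\<^sub>M ?T))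
    = (\<integral>\<^sup>+x. (\<Sum>f\<in>?I \<rightarrow>\<^sub>E {1..M}. w f (fst x) * v f (snd x)) \<partial>(jump_law d H M \<Otimes>\<^sub>M ?T))"
  proof (rule nn_integral_cong)
    fix x assume x: "x \<in> space (jump_law d H M \<Otimes>\<^sub>M ?T)"
    have "(\<Prod>(j, i)\<in>?I. emeasure (normalized (discrete_measure B M (\<lambda>m. fst x (j, m)) (snd x))) (A (j, i)))
      = (\<Prod>y\<in>?I. \<Sum>m\<in>{1..M}. ennreal (fst x (fst y, m) / (\<Sum>m\<in>{1..M}. fst x (fst y, m))) * indicator (A y) (snd x m))"
      using A by (intro prod.cong refl) (auto simp: sample_index_def emeasure_normalized_discrete[OF x M])
    \<comment> \<open>Distributivity: choosing one summand \<open>m\<close> for every index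
      \<open>y\<close> is choosing a labeling.\<close>
    also have "\<dots> = (\<Sum>f\<in>?I \<rightarrow>\<^sub>E {1..M}. \<Prod>y\<in>?I. ennreal (fst x (fst y, f y) / (\<Sum>m\<in>{1..M}. fst x (fst y, m))) * indicator (A y) (snd x (f y)))"
      by (rule prod_sum_PiE) auto
    also have "\<dots> = (\<Sum>f\<in>?I \<rightarrow>\<^sub>E {1..M}. w f (fst x) * v f (snd x))"
      by (simp add: w_def v_def prod.distrib split_beta)
    finally show "(\<Prod>(j, i)\<in>?I. emeasure (normalized (discrete_measure B M (\<lambda>m. fst x (j, m)) (snd x))) (A (j, i)))
      = (\<Sum>f\<in>?I \<rightarrow>\<^sub>E {1..M}. w f (fst x) * v f (snd x))" .
  qed
  also have "\<dots> = (\<Sum>f\<in>?I \<rightarrow>\<^sub>E {1..M}. \<integral>\<^sup>+x. w f (fst x) * v f (snd x) \<partial>(jump_law d H M \<Otimes>\<^sub>M ?T))"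
    using measurable_compose[OF measurable_fst w] measurable_compose[OF measurable_snd v]
    by (intro nn_integral_sum borel_measurable_times_ennreal) auto
  also have "\<dots> = (\<Sum>f\<in>?I \<rightarrow>\<^sub>E {1..M}. label_prob d n H M f * emeasure (tied_law {1..M} ?I B f) (PiE ?I A))"
  proof (rule sum.cong[OF refl])
    fix f assume f: "f \<in> ?I \<rightarrow>\<^sub>E {1..M}"
    have "(\<integral>\<^sup>+x. w f (fst x) * v f (snd x) \<partial>(jump_law d H M \<Otimes>\<^sub>M ?T))
      = (\<integral>\<^sup>+S. \<integral>\<^sup>+t. w f S * v f t \<partial>?T \<partial>jump_law d H M)"
      using measurable_compose[OF measurable_fst w[OF f]] measurable_compose[OF measurable_snd v[OF f]]
      by (subst TT.nn_integral_fst[symmetric]) (auto intro!: borel_measurable_times_ennreal)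
    also have "\<dots> = (\<integral>\<^sup>+S. w f S \<partial>jump_law d H M) * (\<integral>\<^sup>+t. v f t \<partial>?T)"
      using w[OF f] v[OF f] by (simp add: nn_integral_cmult nn_integral_multc)
    also have "(\<integral>\<^sup>+t. v f t \<partial>?T) = emeasure (tied_law {1..M} ?I B f) (PiE ?I A)"
      unfolding v_def using f A by (intro emeasure_tied_law_PiE[symmetric]) auto
    finally show "(\<integral>\<^sup>+x. w f (fst x) * v f (snd x) \<partial>(jump_law d H M \<Otimes>\<^sub>M ?T))
      = label_prob d n H M f * emeasure (tied_law {1..M} ?I B f) (PiE ?I A)"
      by (simp add: label_prob_def w_def)
  qed
  finally show ?thesis .
qed

lemma nn_integral_vec_nifpp:
  assumes B: "prob_space B" and q: "set_pmf q \<subseteq> {1..}"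
    and A: "\<And>x. x \<in> sample_index d n \<Longrightarrow> A x \<in> sets B"
  shows "(\<integral>\<^sup>+p. (\<Prod>(j, i)\<in>sample_index d n. emeasure (p j) (A (j, i))) \<partial>vec_nifpp d q H B)
    = (\<integral>\<^sup>+M. (\<Sum>f\<in>sample_index d n \<rightarrow>\<^sub>E {1..M}. label_prob d n H M f *
        emeasure (tied_law {1..M} (sample_index d n) B f) (PiE (sample_index d n) A)) \<partial>measure_pmf q)"
proof -
  let ?I = "sample_index d n" and ?N = "\<Pi>\<^sub>M j\<in>{1..d}. prob_algebra B"
  let ?D = "\<lambda>M. jump_law d H M \<Otimes>\<^sub>M (\<Pi>\<^sub>M m\<in>{1..M}. B)"
  let ?\<phi> = "\<lambda>M (S, t). \<lambda>j\<in>{1..d}. normalized (discrete_measure B M (\<lambda>m. S (j, m)) t)"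
  let ?g = "\<lambda>p. \<Prod>(j, i)\<in>?I. emeasure (p j) (A (j, i))"
  have prob_D: "prob_space (?D M)" for M
  proof -
    interpret JT: pair_prob_space "jump_law d H M" "\<Pi>\<^sub>M m\<in>{1..M}. B"
      using prob_space_jump_law[of M] prob_space_PiM[of "{1..M}" "\<lambda>_. B"] B
      by (auto simp: pair_prob_space_def pair_sigma_finite_def prob_space_imp_sigma_finite)
    show ?thesis by (rule JT.prob_space_axioms)
  qed
  have ne: "space ?N \<noteq> {}"
    using B by (auto simp: space_PiM PiE_eq_empty_iff space_prob_algebra)
  \<comment> \<open>The kernel must be a subprobability for every \<open>M\<close>, including
    \<open>M = 0\<close>; there it cannot be derived from measurability of the normalizing
    map.\<close>
  have ker: "(\<lambda>M. distr (?D M) ?N (?\<phi> M)) \<in> measure_pmf q \<rightarrow>\<^sub>M subprob_algebra ?N"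
    using distr_in_subprob_algebra[OF prob_D ne] by (auto simp: measurable_def)
  have g: "?g \<in> borel_measurable ?N"
    using A by (rule borel_measurable_prod_emeasure)
  have "(\<integral>\<^sup>+p. ?g p \<partial>vec_nifpp d q H B) = (\<integral>\<^sup>+M. \<integral>\<^sup>+p. ?g p \<partial>distr (?D M) ?N (?\<phi> M) \<partial>measure_pmf q)"
    unfolding vec_nifpp_def jump_law_def[symmetric] by (rule nn_integral_bind[OF g ker])
  also have "\<dots> = (\<integral>\<^sup>+M. (\<Sum>f\<in>?I \<rightarrow>\<^sub>E {1..M}. label_prob d n H M f *
        emeasure (tied_law {1..M} ?I B f) (PiE ?I A)) \<partial>measure_pmf q)"
  \<comment> \<open>Only values of \<open>M\<close> charged by \<open>q\<close> matter. They are at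
    least 1, where the total masses are positive and the \<open>distr\<close> is a true
    push-forward.\<close>
  proof (rule nn_integral_cong_AE, rule AE_pmfI)
    fix M assume "M \<in> set_pmf q"
    then have M: "M \<ge> 1" using q by auto
    have "?\<phi> M \<in> ?D M \<rightarrow>\<^sub>M ?N"
      unfolding jump_law_def by (rule measurable_normalized_discrete[OF sets_H M])
    then have "(\<integral>\<^sup>+p. ?g p \<partial>distr (?D M) ?N (?\<phi> M)) = (\<integral>\<^sup>+x. ?g (?\<phi> M x) \<partial>?D M)"
      by (rule nn_integral_distr) (use g in simp)
    also have "\<dots> = (\<integral>\<^sup>+x. (\<Prod>(j, i)\<in>?I.
        emeasure (normalized (discrete_measure B M (\<lambda>m. fst x (j, m)) (snd x))) (A (j, i))) \<partial>?D M)"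
      by (intro nn_integral_cong prod.cong refl) (auto simp: sample_index_def split_beta)
    finally show "(\<integral>\<^sup>+p. ?g p \<partial>distr (?D M) ?N (?\<phi> M)) = (\<Sum>f\<in>?I \<rightarrow>\<^sub>E {1..M}. label_prob d n H M f *
        emeasure (tied_law {1..M} ?I B f) (PiE ?I A))"
      using nn_integral_prod_normalized_discrete[OF B M A] by simp
  qed
  finally show ?thesis .
qed

text \<open>The conditional law speaks about rectangles, and a tie event is not one. The joint law
  is therefore identified first, with a mixture of the \<open>tied_law\<close> measures, and then
  evaluated at the tie event, where only labelings with the right ties survive.\<close>

lemma emeasure_tie_partition_sample:
  fixes B :: "'a measure"
  assumes B: "prob_space B" and diag: "Measurable.pred (B \<Otimes>\<^sub>M B) (\<lambda>(x, y). x = y)"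
    and diffuse: "\<And>x. x \<in> space B \<Longrightarrow> emeasure B {x} = 0" and q: "set_pmf q \<subseteq> {1..}"
    and W: "prob_space W" and P: "distr W (\<Pi>\<^sub>M j\<in>{1..d}. prob_algebra B) P = vec_nifpp d q H B"
    and S: "conditional_sample W B d n P \<theta>"
  shows "emeasure W {w \<in> space W. tie_partition (sample_index d n) (\<lambda>x. \<theta> x w) = tie_partition (sample_index d n) b}
    = (\<integral>\<^sup>+M. (\<Sum>f | f \<in> sample_index d n \<rightarrow>\<^sub>E {1..M} \<and> tie_partition (sample_index d n) f = tie_partition (sample_index d n) b.
        label_prob d n H M f) \<partial>measure_pmf q)"
proof -
  interpret W: prob_space W by fact
  let ?I = "sample_index d n"
  let ?N = "\<Pi>\<^sub>M x\<in>?I. B"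
  let ?F = "\<lambda>M::nat. ?I \<rightarrow>\<^sub>E {1..M}"
  let ?Q = "tie_partition ?I b"
  let ?E = "{y \<in> space ?N. tie_partition ?I y = ?Q}"
  let ?X = "\<lambda>w. \<lambda>x\<in>?I. \<theta> x w"
  have ne: "space ?N \<noteq> {}"
    using prob_space.not_empty[OF B] by (simp add: space_PiM PiE_eq_empty_iff)
  have D: "tied_law {1..M} ?I B f \<in> space (subprob_algebra ?N)" for M f
    unfolding tied_law_def using B ne by (intro distr_in_subprob_algebra prob_space_PiM) auto
  have fin: "finite (?F M)" for M by (intro finite_PiE finite_sample_index finite_atLeastAtMost)
  have "\<exists>\<nu>. sets \<nu> = sets ?N \<and> (\<forall>A\<in>sets ?N. emeasure \<nu> A =
      (\<integral>\<^sup>+M. (\<Sum>f\<in>?F M. label_prob d n H M f * emeasure (tied_law {1..M} ?I B f) A) \<partial>measure_pmf q))"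
    by (rule mixture_measure_exists[OF D fin])
  then obtain \<nu> where \<nu>0: "sets \<nu> = sets ?N" "\<forall>A\<in>sets ?N. emeasure \<nu> A =
      (\<integral>\<^sup>+M. (\<Sum>f\<in>?F M. label_prob d n H M f * emeasure (tied_law {1..M} ?I B f) A) \<partial>measure_pmf q)"
    by blast
  note \<nu> = \<nu>0(1) bspec[OF \<nu>0(2)]
  have \<theta>: "\<theta> x \<in> W \<rightarrow>\<^sub>M B" if "x \<in> ?I" for x using S that by (simp add: conditional_sample_def)
  then have X: "?X \<in> W \<rightarrow>\<^sub>M ?N" by (rule measurable_restrict)
  have "distr W ?N ?X = \<nu>"
  \<comment> \<open>Rectangles form a generating pi-system, so agreement on them determines the
    law.\<close>
  proof (rule measure_eqI_PiM_finite[of ?I _ "\<lambda>_. B"])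
    fix A assume A: "\<And>x. x \<in> ?I \<Longrightarrow> A x \<in> sets B"
    have R: "PiE ?I A \<in> sets ?N" using A by (intro sets_PiM_I_finite) auto
    have "emeasure (distr W ?N ?X) (PiE ?I A) = emeasure W {w \<in> space W. \<forall>x\<in>?I. \<theta> x w \<in> A x}"
      using X R by (subst emeasure_distr) (auto simp: PiE_iff intro!: arg_cong[where f = "emeasure W"])
    also have "\<dots> = (\<integral>\<^sup>+p. (\<Prod>(j, i)\<in>?I. emeasure (p j) (A (j, i))) \<partial>vec_nifpp d q H B)"
      unfolding P[symmetric] by (rule emeasure_conditional_sample[OF W S]) (rule A)
    also have "\<dots> = (\<integral>\<^sup>+M. (\<Sum>f\<in>?F M. label_prob d n H M f * emeasure (tied_law {1..M} ?I B f) (PiE ?I A)) \<partial>measure_pmf q)"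
      by (rule nn_integral_vec_nifpp[OF B q]) (rule A)
    also have "\<dots> = emeasure \<nu> (PiE ?I A)" by (rule \<nu>(2)[OF R, symmetric])
    finally show "emeasure (distr W ?N ?X) (PiE ?I A) = emeasure \<nu> (PiE ?I A)" .
  next
    \<comment> \<open>The space is itself a rectangle of finite mass, so a constant sequence serves
      as the exhaustion.\<close>
    have "space ?N \<in> prod_algebra ?I (\<lambda>_. B)"
      unfolding space_PiM by (rule space_in_prod_algebra)
    then show "range (\<lambda>_::nat. space ?N) \<subseteq> prod_algebra ?I (\<lambda>_. B)" by auto
    show "(\<Union>i::nat. space ?N) = space ?N" by simp
    show "emeasure (distr W ?N ?X) (space ?N) \<noteq> \<infinity>"
      using X by (simp add: emeasure_distr)
  qed (simp_all add: \<nu>)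
  note law = this
  have E: "?E \<in> sets ?N" by (rule sets_tie_partition[OF diag finite_sample_index])
  have tX: "tie_partition ?I (?X w) = tie_partition ?I (\<lambda>x. \<theta> x w)" for w
    by (simp add: tie_partition_eq_iff)
  have "emeasure W {w \<in> space W. tie_partition ?I (\<lambda>x. \<theta> x w) = ?Q} = emeasure (distr W ?N ?X) ?E"
    using X E measurable_space[OF X] by (subst emeasure_distr) (auto simp: tX intro!: arg_cong[where f = "emeasure W"])
  also have "\<dots> = (\<integral>\<^sup>+M. (\<Sum>f\<in>?F M. label_prob d n H M f * emeasure (tied_law {1..M} ?I B f) ?E) \<partial>measure_pmf q)"
    unfolding law by (rule \<nu>(2)[OF E])
  also have "\<dots> = (\<integral>\<^sup>+M. (\<Sum>f\<in>?F M. label_prob d n H M f * indicator {f. tie_partition ?I f = ?Q} f) \<partial>measure_pmf q)"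
  proof (intro nn_integral_cong sum.cong refl)
    fix M f assume "f \<in> ?F M"
    then have f: "f \<in> ?I \<rightarrow> {1..M}" by auto
    show "label_prob d n H M f * emeasure (tied_law {1..M} ?I B f) ?E = label_prob d n H M f * indicator {f. tie_partition ?I f = ?Q} f"
      using emeasure_tied_law_tie_partition[OF B diag _ _ f E] diffuse by simp
  qed
  also have "\<dots> = (\<integral>\<^sup>+M. (\<Sum>f | f \<in> ?F M \<and> tie_partition ?I f = ?Q. label_prob d n H M f) \<partial>measure_pmf q)"
    using fin by (intro nn_integral_cong sum.mono_neutral_cong_right) (auto simp: indicator_def)
  finally show ?thesis .
qed

text \<open>As \<open>g\<close> is injective, atom \<open>g k\<close> carries the observations of
  block \<open>k\<close> and no others, and atoms outside the image of \<open>g\<close> carry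
  none.\<close>

lemma label_count_block_labeling:
  assumes b: "b \<in> sample_index d n \<rightarrow> {1..K}" and g: "inj_on g {1..K}" and j: "j \<in> {1..d}"
  shows "k \<in> {1..K} \<Longrightarrow> label_count n (\<lambda>x\<in>sample_index d n. g (b x)) j (g k) = card {i \<in> {1..n j}. b (j, i) = k}"
    and "m \<notin> g ` {1..K} \<Longrightarrow> label_count n (\<lambda>x\<in>sample_index d n. g (b x)) j m = 0"
proof -
  have I: "(j, i) \<in> sample_index d n \<longleftrightarrow> i \<in> {1..n j}" for i using j by (auto simp: sample_index_def)
  have b': "b (j, i) \<in> {1..K}" if "i \<in> {1..n j}" for i using b that I by blast
  show "label_count n (\<lambda>x\<in>sample_index d n. g (b x)) j (g k) = card {i \<in> {1..n j}. b (j, i) = k}" if k: "k \<in> {1..K}"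
    unfolding label_count_def by (rule arg_cong[where f = card]) (use I b' k in \<open>auto dest: inj_onD[OF g]\<close>)
  show "label_count n (\<lambda>x\<in>sample_index d n. g (b x)) j m = 0" if m: "m \<notin> g ` {1..K}"
    unfolding label_count_def card_eq_0_iff using I b' m by auto
qed

text \<open>Exactly \<open>K\<close> atoms are occupied, one per block; the other
  \<open>M - K\<close> have count 0. For \<open>kappa\<close> in the role of \<open>\<phi>\<close>,
  the empty atoms produce the power of the Laplace transform.\<close>

lemma prod_label_count:
  fixes \<phi> :: "nat \<Rightarrow> real"
  assumes b: "b ` sample_index d n = {1..K}" and j: "j \<in> {1..d}"
    and f: "f \<in> sample_index d n \<rightarrow>\<^sub>E {1..M}"
      "\<forall>x\<in>sample_index d n. \<forall>y\<in>sample_index d n. f x = f y \<longleftrightarrow> b x = b y"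
  shows "(\<Prod>m\<in>{1..M}. \<phi> (label_count n f j m))
    = (\<Prod>k\<in>{1..K}. \<phi> (card {i \<in> {1..n j}. b (j, i) = k})) * \<phi> 0 ^ (M - K)"
proof -
  have "f \<in> (\<lambda>g. \<lambda>x\<in>sample_index d n. g (b x)) ` {g \<in> {1..K} \<rightarrow>\<^sub>E {1..M}. inj_on g {1..K}}"
    unfolding bij_betw_imp_surj_on[OF bij_betw_labelings[OF b]] using f by simp
  then obtain g where g: "g \<in> {1..K} \<rightarrow>\<^sub>E {1..M}" "inj_on g {1..K}"
    and f_eq: "f = (\<lambda>x\<in>sample_index d n. g (b x))"
    by auto
  have b': "b \<in> sample_index d n \<rightarrow> {1..K}" using b by auto
  note cnt = label_count_block_labeling[OF b' g(2) j, folded f_eq]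
  have sub: "g ` {1..K} \<subseteq> {1..M}" using g(1) by auto
  have "(\<Prod>m\<in>{1..M}. \<phi> (label_count n f j m))
      = (\<Prod>m\<in>{1..M} - g ` {1..K}. \<phi> (label_count n f j m)) * (\<Prod>m\<in>g ` {1..K}. \<phi> (label_count n f j m))"
    using sub by (intro prod.subset_diff) auto
  also have "(\<Prod>m\<in>{1..M} - g ` {1..K}. \<phi> (label_count n f j m)) = \<phi> 0 ^ (M - K)"
    using sub g(2) by (simp add: cnt(2) card_Diff_subset card_image)
  also have "(\<Prod>m\<in>g ` {1..K}. \<phi> (label_count n f j m)) = (\<Prod>k\<in>{1..K}. \<phi> (label_count n f j (g k)))"
    using g(2) by (simp add: prod.reindex)
  also have "\<dots> = (\<Prod>k\<in>{1..K}. \<phi> (card {i \<in> {1..n j}. b (j, i) = k}))"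
    by (intro prod.cong refl) (simp only: cnt(1))
  finally show ?thesis by (simp add: mult.commute)
qed

subsection \<open>The partition probability\<close>

definition counts_weight :: "nat \<Rightarrow> (nat \<Rightarrow> nat \<Rightarrow> nat) \<Rightarrow> (nat \<Rightarrow> real) \<Rightarrow> real" where
  "counts_weight K c u = (\<Prod>j\<in>{1..d}. u j ^ (n j - 1) / Gamma (real (n j)) * (\<Prod>k\<in>{1..K}. kappa (H j) (u j) (c j k)))"

text \<open>Here \<open>m\<close> counts the atoms without observations, so that the total number of
  atoms is \<open>m + K\<close>.\<close>

definition Psi_term :: "nat pmf \<Rightarrow> nat \<Rightarrow> (nat \<Rightarrow> real) \<Rightarrow> nat \<Rightarrow> real" where
  "Psi_term q K u m = pmf q (m + K) * (fact (m + K) / fact m) * (\<Prod>j\<in>{1..d}. laplace (H j) (u j) ^ m)"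

lemma peppf_integrand_eq: "peppf_integrand d q H n K c u = counts_weight K c u * (\<Sum>m. Psi_term q K u m)"
  by (simp add: peppf_integrand_def counts_weight_def Psi_def Psi_term_def)

lemma counts_weight_pos:
  assumes "u \<in> (\<Pi>\<^sub>E j\<in>{1..d}. {0<..})"
  shows "counts_weight K c u > 0"
  unfolding counts_weight_def
proof (rule prod_pos)
  fix j assume j: "j \<in> {1..d}"
  then have u: "u j > 0" using assms by auto
  have "Gamma (real (n j)) > 0" using n[OF j] by (intro Gamma_real_pos) auto
  moreover have "(\<Prod>k\<in>{1..K}. kappa (H j) (u j) (c j k)) > 0"
    by (intro prod_pos) (simp add: kappa_pos[OF prob_H sets_H u])
  ultimately show "u j ^ (n j - 1) / Gamma (real (n j)) * (\<Prod>k\<in>{1..K}. kappa (H j) (u j) (c j k)) > 0"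
    using u by simp
qed

lemma Psi_term_nonneg:
  assumes "u \<in> (\<Pi>\<^sub>E j\<in>{1..d}. {0<..})"
  shows "Psi_term q K u m \<ge> 0"
proof -
  have "laplace (H j) (u j) \<ge> 0" if "j \<in> {1..d}" for j
  proof -
    have "u j > 0" using assms that by auto
    from kappa_pos[OF prob_H sets_H this] show ?thesis by (simp add: laplace_eq_kappa less_imp_le)
  qed
  then show ?thesis unfolding Psi_term_def by (intro mult_nonneg_nonneg prod_nonneg) auto
qed

lemma measurable_kappa_component:
  assumes "j \<in> {1..d}"
  shows "(\<lambda>u. kappa (H j) (u j) r) \<in> borel_measurable (\<Pi>\<^sub>M j\<in>{1..d}. lborel)"
proof -
  have "(\<lambda>u. u j) \<in> borel_measurable (\<Pi>\<^sub>M j\<in>{1..d}. lborel)"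
    using measurable_component_singleton[OF assms, of "\<lambda>_. lborel"] by simp
  then show ?thesis by (rule measurable_compose) (rule borel_measurable_kappa[OF prob_H sets_H])
qed

lemma measurable_counts_weight: "counts_weight K c \<in> borel_measurable (\<Pi>\<^sub>M j\<in>{1..d}. lborel)"
  unfolding counts_weight_def
proof (intro borel_measurable_prod borel_measurable_times)
  fix j assume j: "j \<in> {1..d}"
  show "(\<lambda>u. u j ^ (n j - 1) / Gamma (real (n j))) \<in> borel_measurable (\<Pi>\<^sub>M j\<in>{1..d}. lborel)"
    using measurable_component_singleton[OF j, of "\<lambda>_. lborel"]
    by (intro borel_measurable_divide borel_measurable_power borel_measurable_const) simp
qed (rule measurable_kappa_component)

lemma measurable_Psi_term: "(\<lambda>u. Psi_term q K u m) \<in> borel_measurable (\<Pi>\<^sub>M j\<in>{1..d}. lborel)"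
  unfolding Psi_term_def laplace_eq_kappa
  by (intro borel_measurable_times borel_measurable_prod borel_measurable_power measurable_kappa_component) auto

lemma sets_positive_orthant: "(\<Pi>\<^sub>E j\<in>{1..d}. {0<..}) \<in> sets (\<Pi>\<^sub>M j\<in>{1..d}. (lborel :: real measure))"
  by (intro sets_PiM_I_finite) auto

text \<open>The probability of a labeling depends only on its block counts, so all labelings with
  the ties of \<open>b\<close> contribute equally and the sum is their number times a common value.
  For \<open>M < K\<close> that number is 0, and the truncated exponent \<open>M - K\<close> does no
  harm.\<close>

lemma sum_label_prob:
  assumes b: "b ` sample_index d n = {1..K}"
    and c: "\<And>j k. j \<in> {1..d} \<Longrightarrow> k \<in> {1..K} \<Longrightarrow> card {i \<in> {1..n j}. b (j, i) = k} = c j k"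
    and M: "M \<ge> 1"
  shows "(\<Sum>f | f \<in> sample_index d n \<rightarrow>\<^sub>E {1..M} \<and> tie_partition (sample_index d n) f = tie_partition (sample_index d n) b.
      label_prob d n H M f)
    = of_nat (\<Prod>i<K. M - i) * (\<integral>\<^sup>+u. indicator (\<Pi>\<^sub>E j\<in>{1..d}. {0<..}) u *
        ennreal (counts_weight K c u * (\<Prod>j\<in>{1..d}. laplace (H j) (u j) ^ (M - K))) \<partial>(\<Pi>\<^sub>M j\<in>{1..d}. lborel))"
proof -
  let ?I = "sample_index d n" and ?L = "\<Pi>\<^sub>M j\<in>{1..d}. (lborel :: real measure)"
  let ?F = "{f \<in> ?I \<rightarrow>\<^sub>E {1..M}. \<forall>x\<in>?I. \<forall>y\<in>?I. f x = f y \<longleftrightarrow> b x = b y}"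
  let ?R = "\<integral>\<^sup>+u. indicator (\<Pi>\<^sub>E j\<in>{1..d}. {0<..}) u *
        ennreal (counts_weight K c u * (\<Prod>j\<in>{1..d}. laplace (H j) (u j) ^ (M - K))) \<partial>?L"
  have "label_prob d n H M f = ?R" if f: "f \<in> ?F" for f
  proof -
    have f1: "f \<in> ?I \<rightarrow>\<^sub>E {1..M}" and f2: "\<forall>x\<in>?I. \<forall>y\<in>?I. f x = f y \<longleftrightarrow> b x = b y" using f by auto
    show ?thesis
      unfolding label_prob_eq_integral[OF M f1]
    proof (rule nn_integral_cong)
      fix u :: "nat \<Rightarrow> real" assume u: "u \<in> space ?L"
      let ?x = "\<lambda>j. u j ^ (n j - 1) / Gamma (real (n j)) * (\<Prod>m\<in>{1..M}. kappa (H j) (u j) (label_count n f j m))"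
      show "(\<Prod>j\<in>{1..d}. indicator {0<..} (u j) * ennreal (?x j))
        = indicator (\<Pi>\<^sub>E j\<in>{1..d}. {0<..}) u *
        ennreal (counts_weight K c u * (\<Prod>j\<in>{1..d}. laplace (H j) (u j) ^ (M - K)))"
      proof (cases "\<forall>j\<in>{1..d}. u j > 0")
        case True
        have x: "?x j = u j ^ (n j - 1) / Gamma (real (n j)) * (\<Prod>k\<in>{1..K}. kappa (H j) (u j) (c j k)) * laplace (H j) (u j) ^ (M - K)"
          if j: "j \<in> {1..d}" for j
          using prod_label_count[OF b j f1 f2, of "kappa (H j) (u j)"] c[OF j] by (simp add: laplace_eq_kappa mult.assoc)
        have "?x j \<ge> 0" if j: "j \<in> {1..d}" for j
          using True j n[OF j] kappa_pos[OF prob_H sets_H, of "u j"]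
          by (intro mult_nonneg_nonneg prod_nonneg) (auto simp: less_imp_le)
        then have "(\<Prod>j\<in>{1..d}. indicator {0<..} (u j) * ennreal (?x j)) = ennreal (\<Prod>j\<in>{1..d}. ?x j)"
          using True by (subst prod_ennreal[symmetric]) (auto intro!: prod.cong)
        also have "(\<Prod>j\<in>{1..d}. ?x j) = counts_weight K c u * (\<Prod>j\<in>{1..d}. laplace (H j) (u j) ^ (M - K))"
          unfolding counts_weight_def prod.distrib[symmetric] by (intro prod.cong refl) (rule x)
        finally show ?thesis using True u by (simp add: space_PiM PiE_iff)
      next
        \<comment> \<open>Outside the open orthant one factor of the product on the left vanishes,
          as does the indicator on the right.\<close>
        case False
        then obtain j where j: "j \<in> {1..d}" "\<not> u j > 0" by auto
        then have "(\<Prod>j\<in>{1..d}. indicator {0<..} (u j) * ennreal (?x j)) = 0"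
          by (intro prod_zero bexI[of _ j]) auto
        moreover have "u \<notin> (\<Pi>\<^sub>E j\<in>{1..d}. {0<..})" using j by (auto simp: PiE_iff)
        ultimately show ?thesis by simp
      qed
    qed
  qed
  then have "(\<Sum>f\<in>?F. label_prob d n H M f) = of_nat (card ?F) * ?R" by simp
  then show ?thesis
    using card_labelings[OF b, of "{1..M}"] by (simp add: tie_partition_eq_iff Collect_conj_eq)
qed

text \<open>Averaging over \<open>M\<close> and exchanging sum and integral yields the series of
  \<open>Psi\<close>. It is kept in the extended reals, where the exchange needs no
  convergence.\<close>

lemma nn_integral_sum_label_prob:
  assumes b: "b ` sample_index d n = {1..K}" and q: "set_pmf q \<subseteq> {1..}"
    and c: "\<And>j k. j \<in> {1..d} \<Longrightarrow> k \<in> {1..K} \<Longrightarrow> card {i \<in> {1..n j}. b (j, i) = k} = c j k"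
  shows "(\<integral>\<^sup>+M. (\<Sum>f | f \<in> sample_index d n \<rightarrow>\<^sub>E {1..M} \<and> tie_partition (sample_index d n) f = tie_partition (sample_index d n) b.
      label_prob d n H M f) \<partial>measure_pmf q)
    = (\<integral>\<^sup>+u. indicator (\<Pi>\<^sub>E j\<in>{1..d}. {0<..}) u * (ennreal (counts_weight K c u) * (\<Sum>m. ennreal (Psi_term q K u m)))
        \<partial>(\<Pi>\<^sub>M j\<in>{1..d}. lborel))"
proof -
  let ?L = "\<Pi>\<^sub>M j\<in>{1..d}. (lborel :: real measure)" and ?U = "(\<Pi>\<^sub>E j\<in>{1..d}. {0<..}) :: (nat \<Rightarrow> real) set"
  define R where "R M = (\<integral>\<^sup>+u. indicator ?U u *
        ennreal (counts_weight K c u * (\<Prod>j\<in>{1..d}. laplace (H j) (u j) ^ (M - K))) \<partial>?L)" for M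
  note [measurable] = measurable_counts_weight sets_positive_orthant measurable_Psi_term
  have "(\<integral>\<^sup>+M. (\<Sum>f | f \<in> sample_index d n \<rightarrow>\<^sub>E {1..M} \<and> tie_partition (sample_index d n) f = tie_partition (sample_index d n) b.
      label_prob d n H M f) \<partial>measure_pmf q) = (\<integral>\<^sup>+M. of_nat (\<Prod>i<K. M - i) * R M \<partial>measure_pmf q)"
    unfolding R_def using q by (intro nn_integral_cong_AE AE_pmfI sum_label_prob[OF b c]) auto
  also have "\<dots> = (\<integral>\<^sup>+M. ennreal (pmf q M) * (of_nat (\<Prod>i<K. M - i) * R M) \<partial>count_space UNIV)"
    by (rule nn_integral_measure_pmf)
  \<comment> \<open>For \<open>M < K\<close> the falling factorial vanishes, which allows the shift
    \<open>M = m + K\<close>.\<close>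
  also have "\<dots> = (\<integral>\<^sup>+M. ennreal (pmf q M) * (of_nat (\<Prod>i<K. M - i) * R M) \<partial>count_space {K..})"
    by (rule nn_integral_count_space_eq) (auto simp: prod_diff_eq_0 not_le simp del: of_nat_prod)
  also have "\<dots> = (\<integral>\<^sup>+m. ennreal (pmf q (m + K)) * (of_nat (\<Prod>i<K. (m + K) - i) * R (m + K)) \<partial>count_space UNIV)"
  proof (rule nn_integral_bij_count_space[symmetric])
    show "bij_betw (\<lambda>m. m + K) UNIV {K..}"
      by (rule bij_betwI[where g = "\<lambda>m. m - K"]) auto
  qed
  also have "\<dots> = (\<Sum>m. ennreal (pmf q (m + K)) * (of_nat (\<Prod>i<K. (m + K) - i) * R (m + K)))"
    by (rule nn_integral_count_space_nat)
  also have "\<dots> = (\<Sum>m. \<integral>\<^sup>+u. indicator ?U u * (ennreal (counts_weight K c u) * ennreal (Psi_term q K u m)) \<partial>?L)"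
  proof (rule suminf_cong)
    fix m
    have fd: "real (fact (m + K) div fact m) = fact (m + K) / fact m"
      by (simp add: real_of_nat_div fact_dvd)
    have "ennreal (pmf q (m + K)) * (of_nat (\<Prod>i<K. (m + K) - i) * R (m + K))
      = ennreal (pmf q (m + K) * (fact (m + K) / fact m)) * R (m + K)"
      unfolding prod_diff_eq_fact_div ennreal_of_nat_eq_real_of_nat fd mult.assoc[symmetric]
      by (subst ennreal_mult) simp_all
    also have "\<dots> = (\<integral>\<^sup>+u. ennreal (pmf q (m + K) * (fact (m + K) / fact m)) * (indicator ?U u *
        ennreal (counts_weight K c u * (\<Prod>j\<in>{1..d}. laplace (H j) (u j) ^ m))) \<partial>?L)"
      unfolding R_def
    proof (subst nn_integral_cmult)
      have "(\<lambda>u. \<Prod>j\<in>{1..d}. laplace (H j) (u j) ^ m) \<in> borel_measurable ?L" for m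
        unfolding laplace_eq_kappa by (intro borel_measurable_prod borel_measurable_power measurable_kappa_component)
      note [measurable] = this
      show "(\<lambda>u. indicator ?U u * ennreal (counts_weight K c u * (\<Prod>j\<in>{1..d}. laplace (H j) (u j) ^ m))) \<in> borel_measurable ?L"
        by measurable
    qed simp
    also have "\<dots> = (\<integral>\<^sup>+u. indicator ?U u * (ennreal (counts_weight K c u) * ennreal (Psi_term q K u m)) \<partial>?L)"
    proof (rule nn_integral_cong)
      fix u :: "nat \<Rightarrow> real"
      show "ennreal (pmf q (m + K) * (fact (m + K) / fact m)) * (indicator ?U u *
          ennreal (counts_weight K c u * (\<Prod>j\<in>{1..d}. laplace (H j) (u j) ^ m)))
        = indicator ?U u * (ennreal (counts_weight K c u) * ennreal (Psi_term q K u m))"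
      proof (cases "u \<in> ?U")
        case True
        have cw: "counts_weight K c u \<ge> 0" using counts_weight_pos[OF True] by (rule less_imp_le)
        have lp: "(\<Prod>j\<in>{1..d}. laplace (H j) (u j) ^ m) \<ge> 0"
          using True kappa_pos[OF prob_H sets_H]
          by (intro prod_nonneg) (auto simp: laplace_eq_kappa PiE_iff intro!: zero_le_power less_imp_le)
        have "ennreal x * ennreal (y * z) = ennreal y * ennreal (x * z)" if "x \<ge> 0" "y \<ge> 0" "z \<ge> 0" for x y z :: real
          using that by (simp add: ennreal_mult mult_ac)
        from this[OF _ cw lp, of "pmf q (m + K) * (fact (m + K) / fact m)"]
        show ?thesis using True by (simp add: Psi_term_def)
      qed simp
    qed
    finally show "ennreal (pmf q (m + K)) * (of_nat (\<Prod>i<K. (m + K) - i) * R (m + K))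
      = (\<integral>\<^sup>+u. indicator ?U u * (ennreal (counts_weight K c u) * ennreal (Psi_term q K u m)) \<partial>?L)" .
  qed
  also have "\<dots> = (\<integral>\<^sup>+u. (\<Sum>m. indicator ?U u * (ennreal (counts_weight K c u) * ennreal (Psi_term q K u m))) \<partial>?L)"
    by (rule nn_integral_suminf[symmetric]) measurable
  also have "\<dots> = (\<integral>\<^sup>+u. indicator ?U u * (ennreal (counts_weight K c u) * (\<Sum>m. ennreal (Psi_term q K u m))) \<partial>?L)"
    by (simp add: ennreal_suminf_cmult)
  finally show ?thesis .
qed

text \<open>Convergence of the series is not assumed but deduced: the extended integral equals a
  probability, so its integrand is finite almost everywhere, and there the real series converges to
  the same value.\<close>

theorem vec_nifpp_partition_prob:
  fixes B :: "'a measure"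
  assumes B: "prob_space B" and diag: "Measurable.pred (B \<Otimes>\<^sub>M B) (\<lambda>(x, y). x = y)"
    and diffuse: "\<And>x. x \<in> space B \<Longrightarrow> emeasure B {x} = 0" and q: "set_pmf q \<subseteq> {1..}"
    and W: "prob_space W" and P: "distr W (\<Pi>\<^sub>M j\<in>{1..d}. prob_algebra B) P = vec_nifpp d q H B"
    and S: "conditional_sample W B d n P \<theta>" and C: "blocks_with_counts d n K c C"
  shows "has_bochner_integral (\<Pi>\<^sub>M j\<in>{1..d}. lborel)
    (\<lambda>u. indicator (\<Pi>\<^sub>E j\<in>{1..d}. {0<..}) u *\<^sub>R peppf_integrand d q H n K c u) (partition_prob W d n \<theta> K C)"
proof -
  interpret W: prob_space W by fact
  let ?I = "sample_index d n"
  let ?L = "\<Pi>\<^sub>M j\<in>{1..d}. (lborel :: real measure)" and ?U = "(\<Pi>\<^sub>E j\<in>{1..d}. {0<..}) :: (nat \<Rightarrow> real) set"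
  let ?f = "\<lambda>u. indicator ?U u *\<^sub>R peppf_integrand d q H n K c u"
  from C have "inj_on C {1..K}" "partition_on ?I (C ` {1..K})" by (auto simp: blocks_with_counts_def)
  from partition_block_index[OF this] obtain b where b: "b ` ?I = {1..K}" "tie_partition ?I b = C ` {1..K}"
      and Ck: "\<forall>k\<in>{1..K}. C k = {x \<in> ?I. b x = k}"
    by (elim exE conjE) (rule that)
  have c: "card {i \<in> {1..n j}. b (j, i) = k} = c j k" if "j \<in> {1..d}" "k \<in> {1..K}" for j k
  proof -
    have eq: "{i. (j, i) \<in> C k} = {i \<in> {1..n j}. b (j, i) = k}"
      using bspec[OF Ck that(2)] that(1) by (auto simp: sample_index_def)
    show ?thesis unfolding eq[symmetric] using C that by (simp add: blocks_with_counts_def)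
  qed
  have main: "ennreal (partition_prob W d n \<theta> K C)
    = (\<integral>\<^sup>+u. indicator ?U u * (ennreal (counts_weight K c u) * (\<Sum>m. ennreal (Psi_term q K u m))) \<partial>?L)"
    unfolding partition_prob_def W.emeasure_eq_measure[symmetric] b(2)[symmetric]
    by (subst emeasure_tie_partition_sample[OF B diag _ q W P S], rule diffuse, assumption)
      (rule nn_integral_sum_label_prob[OF b(1) q c])
  have "AE u in ?L. indicator ?U u * (ennreal (counts_weight K c u) * (\<Sum>m. ennreal (Psi_term q K u m))) \<noteq> \<infinity>"
  proof (rule nn_integral_PInf_AE)
    show "(\<lambda>u. indicator ?U u * (ennreal (counts_weight K c u) * (\<Sum>m. ennreal (Psi_term q K u m)))) \<in> borel_measurable ?L"
      by (intro borel_measurable_times_ennreal borel_measurable_indicator borel_measurable_suminf_order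
          measurable_compose[OF measurable_counts_weight measurable_ennreal]
          measurable_compose[OF measurable_Psi_term measurable_ennreal] sets_positive_orthant)
    show "(\<integral>\<^sup>+u. indicator ?U u * (ennreal (counts_weight K c u) * (\<Sum>m. ennreal (Psi_term q K u m))) \<partial>?L) \<noteq> \<infinity>"
      unfolding main[symmetric] by simp
  qed
  \<comment> \<open>The real series is unspecified where it diverges, so nonnegativity is only obtained almost everywhere.\<close>
  then have AE_eq: "AE u in ?L. indicator ?U u * (ennreal (counts_weight K c u) * (\<Sum>m. ennreal (Psi_term q K u m))) = ennreal (?f u)
    \<and> ?f u \<ge> 0"
  proof eventually_elim
    case (elim u)
    show ?case
    proof (cases "u \<in> ?U")
      case True
      note pos = counts_weight_pos[OF True, of K c] and nn = Psi_term_nonneg[OF True, of q K]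
      \<comment> \<open>The weight is strictly positive, so finiteness of the product passes to the
        series.\<close>
      have fin: "(\<Sum>m. ennreal (Psi_term q K u m)) \<noteq> top"
        using elim True pos by (auto simp: ennreal_mult_eq_top_iff)
      have "(\<Sum>m. ennreal (Psi_term q K u m)) = ennreal (\<Sum>m. Psi_term q K u m)"
        using nn fin by (rule suminf_ennreal)
      moreover have "(\<Sum>m. Psi_term q K u m) \<ge> 0"
        using summable_suminf_not_top[OF nn fin] nn by (rule suminf_nonneg)
      ultimately show ?thesis using True pos by (simp add: peppf_integrand_eq ennreal_mult)
    qed simp
  qed
  show ?thesis
  proof (rule has_bochner_integral_nn_integral)
    show "(\<integral>\<^sup>+u. ennreal (?f u) \<partial>?L) = ennreal (partition_prob W d n \<theta> K C)"
      unfolding main using AE_eq by (intro nn_integral_cong_AE) auto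
    show "?f \<in> borel_measurable ?L"
      unfolding peppf_integrand_eq
      by (intro borel_measurable_scaleR borel_measurable_times borel_measurable_indicator borel_measurable_suminf
          measurable_counts_weight measurable_Psi_term sets_positive_orthant)
    show "AE u in ?L. 0 \<le> ?f u" using AE_eq by eventually_elim simp
  qed (simp add: partition_prob_def)
qed

end

section \<open>Specialization to a Borel subset of Euclidean space\<close>

theorem theorem1:
  fixes d K :: nat
    and n :: "nat \<Rightarrow> nat" and c :: "nat \<Rightarrow> nat \<Rightarrow> nat"
    and \<Theta> :: "(real ^ 's) set" and P0 :: "(real ^ 's) measure"
    and q :: "nat pmf"
    and h :: "real \<Rightarrow> real \<Rightarrow> real" and \<gamma> :: "nat \<Rightarrow> real" and H :: "nat \<Rightarrow> real measure"
    and W :: "'w measure"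
    and P :: "'w \<Rightarrow> nat \<Rightarrow> (real ^ 's) measure"
    and \<theta> :: "nat \<times> nat \<Rightarrow> 'w \<Rightarrow> real ^ 's"
    and C :: "nat \<Rightarrow> (nat \<times> nat) set"
  assumes d: "d \<ge> 1"
    and \<Theta>: "\<Theta> \<in> sets borel"
    and P0: "prob_space P0" "sets P0 = sets (restrict_space borel \<Theta>)"
    and P0_diffuse: "\<And>x. x \<in> \<Theta> \<Longrightarrow> measure P0 {x} = 0"
    and q: "set_pmf q \<subseteq> {1..}"
    and \<gamma>: "\<And>j. j \<in> {1..d} \<Longrightarrow> \<gamma> j > 0"
    and h: "\<And>j. j \<in> {1..d} \<Longrightarrow>
              (\<lambda>s. h s (\<gamma> j)) \<in> borel_measurable (restrict_space lborel {0<..})"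
           "\<And>j s. j \<in> {1..d} \<Longrightarrow> s > 0 \<Longrightarrow> h s (\<gamma> j) \<ge> 0"
    and H: "\<And>j. j \<in> {1..d} \<Longrightarrow>
              H j = density (restrict_space lborel {0<..}) (\<lambda>s. ennreal (h s (\<gamma> j)))"
           "\<And>j. j \<in> {1..d} \<Longrightarrow> prob_space (H j)"
    and W: "prob_space W"
    and P: "distr W (\<Pi>\<^sub>M j\<in>{1..d}. prob_algebra P0) P = vec_nifpp d q H P0"
    and sample: "conditional_sample W P0 d n P \<theta>"
    and n: "\<And>j. j \<in> {1..d} \<Longrightarrow> n j \<ge> 1"
    and K: "K \<ge> 1"
    and c: "\<And>j. j \<in> {1..d} \<Longrightarrow> (\<Sum>k\<in>{1..K}. c j k) = n j"
           "\<And>k. k \<in> {1..K} \<Longrightarrow> (\<Sum>j\<in>{1..d}. c j k) > 0"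
    and C: "blocks_with_counts d n K c C"
  shows "set_integrable (\<Pi>\<^sub>M j\<in>{1..d}. lborel) (\<Pi>\<^sub>E j\<in>{1..d}. {0<..}) (peppf_integrand d q H n K c) \<and>
         partition_prob W d n \<theta> K C =
           (LINT u:(\<Pi>\<^sub>E j\<in>{1..d}. {0<..})|(\<Pi>\<^sub>M j\<in>{1..d}. lborel). peppf_integrand d q H n K c u)"
proof -
  \<comment> \<open>Extends the jump laws beyond the \<open>d\<close> groups by a copy of
    \<open>H 1\<close>, which is available because \<open>d\<close> is at least 1, to meet the
    locale's conditions at every index.\<close>
  define H' where "H' j = (if j \<in> {1..d} then H j else H 1)" for j
  have H': "H' j = H j" if "j \<in> {1..d}" for j using that by (simp add: H'_def)
  have sets_H: "sets (H j) = sets (restrict_space borel {0<..})" if "j \<in> {1..d}" for j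
    using H(1)[OF that] by (simp add: sets_restrict_space_cong[OF sets_lborel])
  interpret J: jump_distributions d n H'
  proof (rule jump_distributions.intro)
    have one: "1 \<in> {1..d}" using d by simp
    show "prob_space (H' j)" for j
      unfolding H'_def by (cases "j \<in> {1..d}") (simp_all only: if_True if_False H(2) one)
    show "sets (H' j) = sets (restrict_space borel {0<..})" for j
      unfolding H'_def by (cases "j \<in> {1..d}") (simp_all only: if_True if_False sets_H one)
  qed (rule n)
  interpret P0: prob_space P0 by (rule P0(1))
  have space_P0: "space P0 = \<Theta>"
    using sets_eq_imp_space_eq[OF P0(2)] by (simp add: space_restrict_space)
  have id_P0: "(\<lambda>x. x) \<in> borel_measurable P0"
    by (subst measurable_cong_sets[OF P0(2) refl]) (auto intro: measurable_restrict_space1)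
  \<comment> \<open>Both projections are Borel maps into Euclidean space, where the set of equality
    of two measurable maps is measurable.\<close>
  have diag: "Measurable.pred (P0 \<Otimes>\<^sub>M P0) (\<lambda>(x, y). x = y)"
    using measurable_equality_set[OF measurable_compose[OF measurable_fst id_P0] measurable_compose[OF measurable_snd id_P0]]
    by (simp add: pred_def split_beta)
  have diffuse: "emeasure P0 {x} = 0" if "x \<in> space P0" for x
    using P0_diffuse[of x] that by (simp add: space_P0 P0.emeasure_eq_measure)
  \<comment> \<open>The extension is invisible: both the law of the random measures and the
    integrand read the jump laws only at \<open>j\<close> in \<open>{1..d}\<close>.\<close>
  have "(\<Pi>\<^sub>M (j, m)\<in>{1..d} \<times> {1..M}. H j) = (\<Pi>\<^sub>M (j, m)\<in>{1..d} \<times> {1..M}. H' j)" for M :: nat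
    by (rule PiM_cong) (auto simp: H')
  then have vec: "vec_nifpp d q H P0 = vec_nifpp d q H' P0" by (simp add: vec_nifpp_def)
  have "peppf_integrand d q H n K c u = peppf_integrand d q H' n K c u" for u
    by (simp only: peppf_integrand_def Psi_def H' cong: prod.cong)
  then have integrand: "peppf_integrand d q H n K c = peppf_integrand d q H' n K c" ..
  have hb: "has_bochner_integral (\<Pi>\<^sub>M j\<in>{1..d}. lborel)
    (\<lambda>u. indicator (\<Pi>\<^sub>E j\<in>{1..d}. {0<..}) u *\<^sub>R peppf_integrand d q H' n K c u) (partition_prob W d n \<theta> K C)"
    using diffuse by (intro J.vec_nifpp_partition_prob[OF P0(1) diag _ q W P[unfolded vec] sample C])
  show ?thesis
    unfolding integrand set_integrable_def set_lebesgue_integral_def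
    by (intro conjI has_bochner_integral_integral_eq[OF hb, symmetric] integrable.intros[OF hb])
qed

end
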